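(* Let $1<p\le2$, let $k\ge1$, and let $(f,g)\in C_0^2(\mathbb{R}^2)\times C_0^1(\mathbb{R}^2)$ satisfy $\mathrm{supp}(f,g)\subset\{x\in\mathbb{R}^2:|x|\le k\}$. Suppose that either (i) $1<p<2$, $f\equiv0$, and $g\ge0$ with $g\not\equiv0$; or (ii) $p=2$ and $\int_{\mathbb{R}^2}\{f(x)+g(x)\}\,dx>0$. Then there exist a positive constant $\varepsilon_1=\varepsilon_1(f,g,p,k)$ and a positive constant $c$ independent of $\varepsilon$ such that, for every $0<\varepsilon\le\varepsilon_1$, the integral equation (I) has no solution $u\in C^1(\mathbb{R}^2\times[0,T))$ with $\mathrm{supp}\,u\subset\{(x,t)\in\mathbb{R}^2\times[0,\infty):|x|\le t+k\}$ whenever $T$ satisfies $$ T\ge\begin{cases} c\,\varepsilon^{-(p-1)/(4-2p)} & \text{in case (i)},\\ \exp(c\,\varepsilon^{-1/2}) & \text{in case (ii)}.\end{cases} $$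
   Context: The integral equation (I) is $$u(x,t)=\varepsilon u_L(x,t)+L(|u|^p)(x,t),\qquad (x,t)\in\mathbb{R}^2\times[0,T),$$ where $$u_L(x,t)=\frac{\partial}{\partial t}R(f|x,t)+R(f+g|x,t),\qquad R(\phi|x,t)=\frac{t}{2\pi}\int_{|\xi|\le1}\frac{\phi(x+t\xi)}{\sqrt{1-|\xi|^2}}\,d\xi,$$ and $$L(F)(x,t)=\frac1{2\pi}\int_0^t\frac{t-\tau}{(1+\tau)^{p-1}}\,d\tau\int_{|\xi|\le1}\frac{F(x+(t-\tau)\xi,\tau)}{\sqrt{1-|\xi|^2}}\,d\xi .$$ It is the integral equation associated with the initial value problem $$ u_{tt}-\Delta u=\frac{|u|^p}{(1+t)^{p-1}}\ \text{ in }\mathbb{R}^2\times[0,T),\qquad u(x,0)=\varepsilon f(x),\quad u_t(x,0)=\varepsilon\{f(x)+g(x)\}, $$ which arises via $u=(1+t)v$ from $v_{tt}-\Delta v+\frac{2}{1+t}v_t=|v|^p$, $v(x,0)=\varepsilon f(x)$, $v_t(x,0)=\varepsilon g(x)$. *)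

theory Defs
  imports "HOL-Analysis.Analysis"
begin

definition supp_on :: "'a::topological_space set \<Rightarrow> ('a \<Rightarrow> 'b::monoid_add) \<Rightarrow> 'a set" where
  "supp_on S u = closure (support_on S u)"

(* Derivatives are taken within S, so for S = R^2 x [0,T) they are one-sided in time at t = 0;
   there the derivative within S is still unique. *)
definition C1_on :: "'a::real_normed_vector set \<Rightarrow> ('a \<Rightarrow> 'b::real_normed_vector) \<Rightarrow> bool" where
  "C1_on S u \<longleftrightarrow>
     (\<exists>u' :: 'a \<Rightarrow> 'a \<Rightarrow>\<^sub>L 'b.
        (\<forall>z\<in>S. (u has_derivative blinfun_apply (u' z)) (at z within S)) \<and> continuous_on S u')"

definition C2_on :: "'a::real_normed_vector set \<Rightarrow> ('a \<Rightarrow> 'b::real_normed_vector) \<Rightarrow> bool" where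
  "C2_on S u \<longleftrightarrow>
     (\<exists>u' :: 'a \<Rightarrow> 'a \<Rightarrow>\<^sub>L 'b.
        (\<forall>z\<in>S. (u has_derivative blinfun_apply (u' z)) (at z within S)) \<and> C1_on S u')"

definition C1_0 :: "(real^2 \<Rightarrow> real) set" where
  "C1_0 = {\<phi>. C1_on UNIV \<phi> \<and> compact (supp_on UNIV \<phi>)}"

definition C2_0 :: "(real^2 \<Rightarrow> real) set" where
  "C2_0 = {\<phi>. C2_on UNIV \<phi> \<and> compact (supp_on UNIV \<phi>)}"

(* On the unit circle the quotient is 0 by the convention y / 0 = 0; this is a null set. *)
definition disc_integral :: "(real^2 \<Rightarrow> real) \<Rightarrow> real" where
  "disc_integral \<psi> = (LINT \<xi>:cball 0 1|lborel. \<psi> \<xi> / sqrt (1 - (norm \<xi>)\<^sup>2))"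

definition wave_R :: "(real^2 \<Rightarrow> real) \<Rightarrow> real^2 \<Rightarrow> real \<Rightarrow> real" where
  "wave_R \<phi> x t = t / (2 * pi) * disc_integral (\<lambda>\<xi>. \<phi> (x + t *\<^sub>R \<xi>))"

(* wave_R is defined for all real t, so the time derivative at t = 0 is two-sided; for
   continuously differentiable f it agrees with the one-sided one. *)
definition u_lin :: "(real^2 \<Rightarrow> real) \<Rightarrow> (real^2 \<Rightarrow> real) \<Rightarrow> real^2 \<Rightarrow> real \<Rightarrow> real" where
  "u_lin f g x t = deriv (\<lambda>s. wave_R f x s) t + wave_R (\<lambda>y. f y + g y) x t"

definition duhamel_L :: "real \<Rightarrow> ((real^2) \<times> real \<Rightarrow> real) \<Rightarrow> real^2 \<Rightarrow> real \<Rightarrow> real" where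
  "duhamel_L p F x t =
     1 / (2 * pi) *
     (LINT \<tau>:{0..t}|lborel.
        (t - \<tau>) / (1 + \<tau>) powr (p - 1) * disc_integral (\<lambda>\<xi>. F (x + (t - \<tau>) *\<^sub>R \<xi>, \<tau>)))"

definition space_time :: "real \<Rightarrow> ((real^2) \<times> real) set" where
  "space_time T = UNIV \<times> {0..<T}"

definition solves_integral_eq ::
  "real \<Rightarrow> real \<Rightarrow> (real^2 \<Rightarrow> real) \<Rightarrow> (real^2 \<Rightarrow> real) \<Rightarrow> real \<Rightarrow> ((real^2) \<times> real \<Rightarrow> real) \<Rightarrow> bool" where
  "solves_integral_eq p \<epsilon> f g T u \<longleftrightarrow>
     (\<forall>(x, t) \<in> space_time T.
        u (x, t) = \<epsilon> * u_lin f g x t + duhamel_L p (\<lambda>z. \<bar>u z\<bar> powr p) x t)"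

end

theory Submission
  imports Defs
begin

text \<open>
  Only lower bounds for \<open>u\<close> inside a truncated cone \<open>|x| \<le> t - l\<close> are needed. A source located
  there at time \<open>\<tau>\<close> stays in the cone at all later times and contributes its full mass. So
  \<open>V(t)\<close>, the integral of \<open>u(t)\<close> over \<open>|x| \<le> t - l\<close>, dominates the integral of
  \<open>(t - \<tau>) (1 + \<tau>) powr (1 - p) N(\<tau>)\<close> over \<open>0 \<le> \<tau> \<le> t\<close>, where \<open>N(\<tau>)\<close> is the mass of \<open>|u|^p\<close> in
  the cone; and \<open>N\<close> is at least a constant times \<open>V^p / \<tau>^(2 (p - 1))\<close>. This self-improving
  inequality makes \<open>V\<close> infinite on \<open>[T/2, T)\<close> as soon as \<open>V \<ge> A\<close> there with \<open>A\<close> larger than a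
  constant times \<open>T powr ((3 p - 5) / (p - 1))\<close>.

  In case (i) take \<open>l = -k\<close>; the linear part gives \<open>A\<close> of size \<open>\<epsilon> T\<close>.

  In case (ii) choose \<open>l\<close> so large that \<open>u_L \<ge> m / (2 pi sqrt (t^2 - |x|^2))\<close> in the cone. By the
  reverse triangle inequality of Minkowski space every source near the origin also contributes
  at least its mass times this kernel, so \<open>J(s)\<close>, the integral of \<open>N(\<tau>) / (1 + \<tau>)\<close> over
  \<open>0 \<le> \<tau> < s\<close>, satisfies \<open>2 pi sqrt (t^2 - |x|^2) u \<ge> \<epsilon> m + J((t - |x|) / 2)\<close>. Squaring and
  integrating produces a logarithm: in the variable \<open>log s\<close> one has \<open>J'' \<ge> c (\<epsilon> m + J)^2\<close> up to a
  bounded delay. Doubling \<open>\<epsilon> m + J\<close> from the level \<open>a\<close> takes a logarithmic time of order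
  \<open>1 + a powr (-1/2)\<close>, and these times add up to \<open>O(\<epsilon> powr (-1/2))\<close> until \<open>J\<close> exceeds a large
  constant; then \<open>V \<ge> (t/2) J(t/2)\<close> starts the blow-up.
\<close>

section \<open>Circular means in the plane\<close>

lemma cball_in_sets_borel [measurable]: "cball (a::'a::metric_space) r \<in> sets borel"
  by (simp add: borel_closed)

lemma emeasure_cball_2:
  "a \<ge> 0 \<Longrightarrow> emeasure lborel (cball (c::real^2) a) = ennreal (pi * a\<^sup>2)"
  by (simp add: emeasure_cball unit_ball_vol_2)

text \<open>Polar coordinates for radial integrands. Both measures are determined by their values on
  the half-lines \<open>{..a}\<close>, where they give the area of the disc of radius
  \<open>a\<close> and the integral of \<open>2 * pi * r\<close> from 0 to \<open>a\<close>.\<close>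

lemma distr_norm_lborel_2:
  "distr lborel borel (norm :: real^2 \<Rightarrow> real) =
   density lborel (\<lambda>r. ennreal (2 * pi * r) * indicator {0..} r)"
proof (rule measure_eqI_generator_eq[where E = "range atMost" and \<Omega> = UNIV and A = "\<lambda>n::nat. {..real n}"])
  have E: "borel = sigma UNIV (range (\<lambda>a::real. {..a}))"
    by (rule borel_eq_atMost)
  show "sets (distr lborel borel (norm :: real^2 \<Rightarrow> real)) = sigma_sets UNIV (range atMost)"
    by (simp add: E)
  show "sets (density lborel (\<lambda>r. ennreal (2 * pi * r) * indicator {0..} r)) = sigma_sets UNIV (range atMost)"
    by (simp add: E)
  show "Int_stable (range (atMost :: real \<Rightarrow> real set))"
    by (auto simp: Int_stable_def)
  show "(\<Union>i::nat. {..real i}) = UNIV"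
    by (auto simp: real_arch_simple)
  have *: "emeasure (distr lborel borel (norm :: real^2 \<Rightarrow> real)) {..a} =
     (if a < 0 then 0 else ennreal (pi * a\<^sup>2))" for a
  proof -
    have "norm -` {..a} = cball (0::real^2) a" by auto
    then show ?thesis by (simp add: emeasure_distr emeasure_cball_2 )
  qed
  show "emeasure (distr lborel borel (norm :: real^2 \<Rightarrow> real)) {..real i} \<noteq> \<infinity>" for i
    by (simp add: *)
  fix X :: "real set" assume "X \<in> range atMost"
  then obtain a where X: "X = {..a}" by auto
  have "emeasure (density lborel (\<lambda>r. ennreal (2 * pi * r) * indicator {0..} r)) {..a} =
     (\<integral>\<^sup>+r. ennreal (2 * pi * r) * indicator {0..a} r \<partial>lborel)"
    by (subst emeasure_density) (auto intro!: nn_integral_cong simp: indicator_def)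
  also have "\<dots> = (if a < 0 then 0 else ennreal (pi * a\<^sup>2))"
  proof (cases "a < 0")
    case False
    then have "(\<integral>\<^sup>+r. ennreal (2 * pi * r) * indicator {0..a} r \<partial>lborel) = ennreal (pi * a\<^sup>2 - pi * 0\<^sup>2)"
      by (intro nn_integral_FTC_Icc) (auto intro!: derivative_eq_intros)
    with False show ?thesis by simp
  qed simp
  finally show "emeasure (distr lborel borel (norm :: real^2 \<Rightarrow> real)) X =
    emeasure (density lborel (\<lambda>r. ennreal (2 * pi * r) * indicator {0..} r)) X"
    using * X by simp
qed auto

lemma nn_integral_radial_2:
  fixes h :: "real \<Rightarrow> ennreal"
  assumes [measurable]: "h \<in> borel_measurable borel"
  shows "(\<integral>\<^sup>+x. h (norm (x::real^2)) \<partial>lborel) =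
    (\<integral>\<^sup>+r. ennreal (2 * pi * r) * indicator {0..} r * h r \<partial>lborel)"
proof -
  have "(\<integral>\<^sup>+x. h (norm (x::real^2)) \<partial>lborel) = (\<integral>\<^sup>+r. h r \<partial>distr lborel borel (norm :: real^2 \<Rightarrow> real))"
    by (simp add: nn_integral_distr)
  also have "\<dots> = (\<integral>\<^sup>+r. ennreal (2 * pi * r) * indicator {0..} r * h r \<partial>lborel)"
    unfolding distr_norm_lborel_2 by (subst nn_integral_density) simp_all
  finally show ?thesis .
qed

text \<open>Extending the weight by zero off the disc turns \<open>disc_integral\<close> into an
  integral over the whole plane, to which translation, scaling and Tonelli apply directly.\<close>

definition disc_weight :: "real^2 \<Rightarrow> real" where
  "disc_weight \<xi> = indicator (cball 0 1) \<xi> / sqrt (1 - (norm \<xi>)\<^sup>2)"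

lemma disc_weight_nonneg [simp]: "disc_weight \<xi> \<ge> 0"
  by (auto simp: disc_weight_def indicator_def power_le_one)

lemma disc_weight_measurable [measurable]: "disc_weight \<in> borel_measurable borel"
  unfolding disc_weight_def
  by (intro borel_measurable_divide borel_measurable_indicator borel_measurable_continuous_onI continuous_intros) auto

lemma disc_integral_eq: "disc_integral \<psi> = (LINT \<xi>|lborel. disc_weight \<xi> * \<psi> \<xi>)"
  unfolding disc_integral_def set_lebesgue_integral_def disc_weight_def
  by (simp add: mult.commute)

text \<open>This normalisation makes \<open>disc_integral\<close> divided by \<open>2 * pi\<close> a
  weighted average over the disc.\<close>

lemma nn_integral_disc_weight: "(\<integral>\<^sup>+\<xi>. ennreal (disc_weight \<xi>) \<partial>lborel) = ennreal (2 * pi)"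
proof -
  let ?h = "\<lambda>r::real. indicator {0..1} r / sqrt (1 - r\<^sup>2)"
  have "(\<integral>\<^sup>+\<xi>. ennreal (disc_weight \<xi>) \<partial>lborel) = (\<integral>\<^sup>+\<xi>. ennreal (?h (norm \<xi>)) \<partial>(lborel :: (real^2) measure))"
    by (intro nn_integral_cong) (auto simp: disc_weight_def indicator_def)
  also have "\<dots> = (\<integral>\<^sup>+r. ennreal (2 * pi * r) * indicator {0..} r * ennreal (?h r) \<partial>lborel)"
    by (rule nn_integral_radial_2) measurable
  also have "\<dots> = (\<integral>\<^sup>+r. ennreal (indicator {0..1} r * (2 * pi * r / sqrt (1 - r\<^sup>2))) \<partial>lborel)"
    by (intro nn_integral_cong) (auto simp: indicator_def ennreal_mult[symmetric] power_le_one)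
  also have "\<dots> = ennreal (2 * pi)"
  proof (rule nn_integral_has_integral_lborel)
    \<comment> \<open>The primitive is continuous up to \<open>r = 1\<close> but not differentiable
      there, hence the version of the fundamental theorem with derivatives only in the
      interior.\<close>
    have "((\<lambda>r. 2 * pi * r / sqrt (1 - r\<^sup>2)) has_integral (- 2 * pi * sqrt (1 - 1\<^sup>2)) - (- 2 * pi * sqrt (1 - 0\<^sup>2))) {0..1}"
    proof (rule fundamental_theorem_of_calculus_interior)
      fix r :: real assume r: "r \<in> {0<..<1}"
      then have "r\<^sup>2 < 1" by (simp add: power_less_one_iff)
      then show "((\<lambda>r. - 2 * pi * sqrt (1 - r\<^sup>2)) has_vector_derivative 2 * pi * r / sqrt (1 - r\<^sup>2)) (at r)"
        unfolding has_real_derivative_iff_has_vector_derivative[symmetric]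
        by (auto intro!: derivative_eq_intros simp: field_simps)
    qed (auto intro!: continuous_intros)
    then have "((\<lambda>r. 2 * pi * r / sqrt (1 - r\<^sup>2)) has_integral 2 * pi) {0..1}" by simp
    then have "((\<lambda>r. if r \<in> {0..1} then 2 * pi * r / sqrt (1 - r\<^sup>2) else 0) has_integral 2 * pi) UNIV"
      by (simp only: has_integral_restrict_UNIV)
    then show "((\<lambda>r. indicator {0..1} r * (2 * pi * r / sqrt (1 - r\<^sup>2))) has_integral 2 * pi) UNIV"
      by (rule has_integral_eq[rotated]) (auto simp: indicator_def)
  qed (auto simp: indicator_def power_le_one)
  finally show ?thesis .
qed

section \<open>Integrals of bounded functions against the disc weight\<close>

lemma integrable_disc_weight_mult:
  assumes [measurable]: "\<psi> \<in> borel_measurable borel"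
    and b: "\<And>\<xi>. norm \<xi> \<le> 1 \<Longrightarrow> \<bar>\<psi> \<xi>\<bar> \<le> C"
  shows "integrable lborel (\<lambda>\<xi>. disc_weight \<xi> * \<psi> \<xi>)"
proof (rule Bochner_Integration.integrable_bound)
  show "integrable lborel (\<lambda>\<xi>. C * disc_weight \<xi>)"
    by (intro integrable_mult_right integrableI_nonneg) (simp_all add: nn_integral_disc_weight)
  have C: "C \<ge> 0" using b[of 0] by simp
  show "AE \<xi> in lborel. norm (disc_weight \<xi> * \<psi> \<xi>) \<le> norm (C * disc_weight \<xi>)"
  proof (rule AE_I2)
    fix \<xi> :: "real^2"
    show "norm (disc_weight \<xi> * \<psi> \<xi>) \<le> norm (C * disc_weight \<xi>)"
    proof (cases "norm \<xi> \<le> 1")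
      case True
      from mult_right_mono[OF b[OF this] disc_weight_nonneg] C show ?thesis
        by (simp add: abs_mult mult.commute)
    qed (simp add: disc_weight_def)
  qed
qed measurable

text \<open>The bound on the disc yields integrability, so the Bochner integral is not the default
  value 0 and agrees with the nonnegative integral.\<close>

lemma ennreal_disc_integral:
  assumes [measurable]: "\<psi> \<in> borel_measurable borel"
    and b: "\<And>\<xi>. norm \<xi> \<le> 1 \<Longrightarrow> \<psi> \<xi> \<le> C" and nn: "\<And>\<xi>. \<psi> \<xi> \<ge> 0"
  shows "ennreal (disc_integral \<psi>) = (\<integral>\<^sup>+\<xi>. ennreal (disc_weight \<xi>) * ennreal (\<psi> \<xi>) \<partial>lborel)"
proof -
  have "integrable lborel (\<lambda>\<xi>. disc_weight \<xi> * \<psi> \<xi>)"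
    by (rule integrable_disc_weight_mult[where C = C]) (use b nn in auto)
  from nn_integral_eq_integral[OF this] nn show ?thesis
    by (simp add: disc_integral_eq ennreal_mult')
qed

lemma disc_integral_le:
  assumes [measurable]: "\<psi> \<in> borel_measurable borel"
    and b: "\<And>\<xi>. norm \<xi> \<le> 1 \<Longrightarrow> \<psi> \<xi> \<le> C" and nn: "\<And>\<xi>. \<psi> \<xi> \<ge> 0"
  shows "disc_integral \<psi> \<le> 2 * pi * C"
proof -
  have C: "C \<ge> 0" using b[of 0] nn[of 0] by simp
  have "ennreal (disc_integral \<psi>) \<le> (\<integral>\<^sup>+\<xi>. ennreal (disc_weight \<xi>) * ennreal C \<partial>lborel)"
    by (subst ennreal_disc_integral[where C = C], use assms in \<open>simp_all del: times_ennreal.abs_eq\<close>, intro nn_integral_mono) (use b in \<open>auto simp: disc_weight_def indicator_def intro!: mult_left_mono ennreal_leI\<close>)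
  also have "\<dots> = ennreal (2 * pi * C)"
    using C by (simp add: nn_integral_multc nn_integral_disc_weight ennreal_mult)
  finally show ?thesis using C by (simp add: ennreal_le_iff)
qed

lemma disc_integral_nonneg: "(\<And>\<xi>. \<psi> \<xi> \<ge> 0) \<Longrightarrow> disc_integral \<psi> \<ge> 0"
  by (simp add: disc_integral_eq)

text \<open>Up to the factor \<open>1 / (2 * pi)\<close>, the fundamental solution of the
  two-dimensional wave equation at time \<open>r\<close>.\<close>

definition wave_kernel :: "real \<Rightarrow> real^2 \<Rightarrow> real" where
  "wave_kernel r z = indicator (cball 0 r) z / sqrt (r\<^sup>2 - (norm z)\<^sup>2)"

lemma wave_kernel_scale:
  assumes "r > 0"
  shows "wave_kernel r (r *\<^sub>R \<xi>) = disc_weight \<xi> / r"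
proof -
  have "r\<^sup>2 - (norm (r *\<^sub>R \<xi>))\<^sup>2 = r\<^sup>2 * (1 - (norm \<xi>)\<^sup>2)"
    by (simp add: power_mult_distrib algebra_simps)
  then show ?thesis
    using assms by (simp add: wave_kernel_def disc_weight_def real_sqrt_mult indicator_def mult.commute)
qed

lemma wave_kernel_measurable [measurable]: "wave_kernel r \<in> borel_measurable borel"
  unfolding wave_kernel_def
  by (intro borel_measurable_divide borel_measurable_indicator borel_measurable_continuous_onI continuous_intros) auto

text \<open>Substitute \<open>y = x + r *\<^sub>R \<xi>\<close>: the Jacobian
  \<open>r\<^sup>2\<close> meets the factor \<open>1 / r\<close> from
  \<open>wave_kernel_scale\<close>, which leaves \<open>r\<close> in front of the disc mean.\<close>

lemma nn_integral_disc_weight_eq_kernel: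
  fixes \<phi> :: "real^2 \<Rightarrow> ennreal"
  assumes [measurable]: "\<phi> \<in> borel_measurable borel" and r: "r > 0"
  shows "ennreal r * (\<integral>\<^sup>+\<xi>. ennreal (disc_weight \<xi>) * \<phi> (x + r *\<^sub>R \<xi>) \<partial>lborel) =
    (\<integral>\<^sup>+y. ennreal (wave_kernel r (y - x)) * \<phi> y \<partial>lborel)"
proof -
  have "(\<integral>\<^sup>+y. ennreal (wave_kernel r (y - x)) * \<phi> y \<partial>lborel) =
     (\<integral>\<^sup>+\<xi>. ennreal (r\<^sup>2) * (ennreal (wave_kernel r (r *\<^sub>R \<xi>)) * \<phi> (x + r *\<^sub>R \<xi>)) \<partial>lborel)"
    using r by (subst lborel_affine[of r x]) (simp_all add: nn_integral_density nn_integral_distr)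
  also have "\<dots> = (\<integral>\<^sup>+\<xi>. ennreal r * (ennreal (disc_weight \<xi>) * \<phi> (x + r *\<^sub>R \<xi>)) \<partial>lborel)"
  proof (rule nn_integral_cong)
    fix \<xi> :: "real^2"
    have "ennreal (r\<^sup>2) * ennreal (wave_kernel r (r *\<^sub>R \<xi>)) = ennreal r * ennreal (disc_weight \<xi>)"
      using r by (simp add: wave_kernel_scale ennreal_mult[symmetric] power2_eq_square)
    then show "ennreal (r\<^sup>2) * (ennreal (wave_kernel r (r *\<^sub>R \<xi>)) * \<phi> (x + r *\<^sub>R \<xi>)) =
        ennreal r * (ennreal (disc_weight \<xi>) * \<phi> (x + r *\<^sub>R \<xi>))"
      by (metis mult.assoc)
  qed
  also have "\<dots> = ennreal r * (\<integral>\<^sup>+\<xi>. ennreal (disc_weight \<xi>) * \<phi> (x + r *\<^sub>R \<xi>) \<partial>lborel)"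
    by (rule nn_integral_cmult) measurable
  finally show ?thesis by simp
qed

lemma disc_integral_eq_kernel:
  fixes \<phi> :: "real^2 \<Rightarrow> real"
  assumes [measurable]: "\<phi> \<in> borel_measurable borel" and r: "r > 0"
  shows "r * disc_integral (\<lambda>\<xi>. \<phi> (x + r *\<^sub>R \<xi>)) = (LINT y|lborel. wave_kernel r (y - x) * \<phi> y)"
proof -
  have "(LINT y|lborel. wave_kernel r (y - x) * \<phi> y) =
     (LINT \<xi>|lborel. r\<^sup>2 *\<^sub>R (wave_kernel r (r *\<^sub>R \<xi>) * \<phi> (x + r *\<^sub>R \<xi>)))"
    using r by (subst lborel_affine[of r x]) (simp_all add: integral_density integral_distr)
  also have "\<dots> = (LINT \<xi>|lborel. r * (disc_weight \<xi> * \<phi> (x + r *\<^sub>R \<xi>)))"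
    using r by (intro Bochner_Integration.integral_cong) (simp_all add: wave_kernel_scale power2_eq_square)
  also have "\<dots> = r * disc_integral (\<lambda>\<xi>. \<phi> (x + r *\<^sub>R \<xi>))"
    by (simp add: disc_integral_eq)
  finally show ?thesis by simp
qed

text \<open>Waves emitted from the ball of radius \<open>b\<close> stay in the ball of radius \<open>b + r\<close>, so no mass is lost.\<close>

lemma nn_integral_spherical_mean_ge:
  fixes \<phi> :: "real^2 \<Rightarrow> ennreal"
  assumes [measurable]: "\<phi> \<in> borel_measurable borel" and r: "r \<ge> 0"
  shows "ennreal (2 * pi) * (\<integral>\<^sup>+y. \<phi> y * indicator (cball 0 b) y \<partial>lborel) \<le>
    (\<integral>\<^sup>+x. (\<integral>\<^sup>+\<xi>. ennreal (disc_weight \<xi>) * \<phi> (x + r *\<^sub>R \<xi>) \<partial>lborel) * indicator (cball 0 (b + r)) x \<partial>lborel)"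
proof -
  \<comment> \<open>The factor \<open>2 * pi\<close> is written as the integral of the weight, so
    that the claim can be checked for each shift by \<open>r *\<^sub>R \<xi>\<close> separately;
    Tonelli then exchanges the integrals.\<close>
  have "ennreal (2 * pi) * (\<integral>\<^sup>+y. \<phi> y * indicator (cball 0 b) y \<partial>lborel) =
      (\<integral>\<^sup>+\<xi>. ennreal (disc_weight \<xi>) * (\<integral>\<^sup>+y. \<phi> y * indicator (cball 0 b) y \<partial>lborel) \<partial>lborel)"
    by (simp add: nn_integral_multc nn_integral_disc_weight)
  also have "\<dots> \<le> (\<integral>\<^sup>+\<xi>. ennreal (disc_weight \<xi>) * (\<integral>\<^sup>+x. \<phi> (x + r *\<^sub>R \<xi>) * indicator (cball 0 (b + r)) x \<partial>lborel) \<partial>lborel)"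
  proof (rule nn_integral_mono)
    fix \<xi> :: "real^2"
    show "ennreal (disc_weight \<xi>) * (\<integral>\<^sup>+y. \<phi> y * indicator (cball 0 b) y \<partial>lborel) \<le>
       ennreal (disc_weight \<xi>) * (\<integral>\<^sup>+x. \<phi> (x + r *\<^sub>R \<xi>) * indicator (cball 0 (b + r)) x \<partial>lborel)"
    proof (cases "norm \<xi> \<le> 1")
      case True
      have "(\<integral>\<^sup>+y. \<phi> y * indicator (cball 0 b) y \<partial>lborel) =
        (\<integral>\<^sup>+y. \<phi> y * indicator (cball 0 b) y \<partial>distr lborel borel ((+) (r *\<^sub>R \<xi>)))"
        by (simp only: lborel_distr_plus)
      also have "\<dots> = (\<integral>\<^sup>+x. \<phi> (r *\<^sub>R \<xi> + x) * indicator (cball 0 b) (r *\<^sub>R \<xi> + x) \<partial>lborel)"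
        by (rule nn_integral_distr) measurable
      also have "\<dots> \<le> (\<integral>\<^sup>+x. \<phi> (x + r *\<^sub>R \<xi>) * indicator (cball 0 (b + r)) x \<partial>lborel)"
      proof (rule nn_integral_mono)
        fix x
        have "norm x \<le> b + r" if "norm (r *\<^sub>R \<xi> + x) \<le> b"
        proof -
          have "norm x \<le> norm (r *\<^sub>R \<xi> + x) + norm (r *\<^sub>R \<xi>)"
            using norm_triangle_ineq4[of "r *\<^sub>R \<xi> + x" "r *\<^sub>R \<xi>"] by simp
          also have "norm (r *\<^sub>R \<xi>) \<le> r" using True r by (simp add: mult_left_le)
          finally show ?thesis using that by simp
        qed
        then show "\<phi> (r *\<^sub>R \<xi> + x) * indicator (cball 0 b) (r *\<^sub>R \<xi> + x) \<le> \<phi> (x + r *\<^sub>R \<xi>) * indicator (cball 0 (b + r)) x"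
          by (auto simp: indicator_def add.commute)
      qed
      finally show ?thesis by (rule mult_left_mono) simp
    qed (simp add: disc_weight_def)
  qed
  also have "\<dots> = (\<integral>\<^sup>+\<xi>. (\<integral>\<^sup>+x. ennreal (disc_weight \<xi>) * (\<phi> (x + r *\<^sub>R \<xi>) * indicator (cball 0 (b + r)) x) \<partial>lborel) \<partial>lborel)"
    by (intro nn_integral_cong nn_integral_cmult[symmetric]) measurable
  also have "\<dots> = (\<integral>\<^sup>+x. (\<integral>\<^sup>+\<xi>. ennreal (disc_weight \<xi>) * (\<phi> (x + r *\<^sub>R \<xi>) * indicator (cball 0 (b + r)) x) \<partial>lborel) \<partial>lborel)"
    by (rule lborel_pair.Fubini') measurable
  also have "\<dots> = (\<integral>\<^sup>+x. (\<integral>\<^sup>+\<xi>. ennreal (disc_weight \<xi>) * \<phi> (x + r *\<^sub>R \<xi>) \<partial>lborel) * indicator (cball 0 (b + r)) x \<partial>lborel)"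
    by (intro nn_integral_cong) (simp add: nn_integral_multc mult.assoc[symmetric])
  finally show ?thesis .
qed

section \<open>Duhamel's integral\<close>

text \<open>Duhamel's integral with values in the extended nonnegative reals: Tonelli and
  monotonicity become available without integrability side conditions.\<close>

definition nn_duhamel :: "real \<Rightarrow> ((real^2) \<times> real \<Rightarrow> ennreal) \<Rightarrow> real^2 \<Rightarrow> real \<Rightarrow> ennreal" where
  "nn_duhamel p H x t = ennreal (1 / (2 * pi)) *
     (\<integral>\<^sup>+\<tau>. ennreal ((t - \<tau>) / (1 + \<tau>) powr (p - 1)) * indicator {0..t} \<tau> *
        (\<integral>\<^sup>+\<xi>. ennreal (disc_weight \<xi>) * H (x + (t - \<tau>) *\<^sub>R \<xi>, \<tau>) \<partial>lborel) \<partial>lborel)"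

lemma duhamel_L_nonneg: "(\<And>z. F z \<ge> 0) \<Longrightarrow> duhamel_L p F x t \<ge> 0"
  unfolding duhamel_L_def set_lebesgue_integral_def
  by (intro mult_nonneg_nonneg Bochner_Integration.integral_nonneg)
    (auto simp: indicator_def intro!: divide_nonneg_nonneg mult_nonneg_nonneg disc_integral_nonneg)

text \<open>The value at \<open>(x, t)\<close> only involves \<open>F\<close> on the compact set
  \<open>cball x t \<times> {0..t}\<close>, where it is bounded; hence both nested Bochner integrals
  exist. \<open>H\<close> is a separate argument because it may differ from \<open>F\<close> at
  times outside \<open>{0..t}\<close>.\<close>

lemma ennreal_duhamel_L:
  assumes cont: "continuous_on (UNIV \<times> {0..t}) F" and nn: "\<And>z. F z \<ge> 0" and p: "p \<ge> 1"
    and H: "\<And>y \<tau>. \<tau> \<in> {0..t} \<Longrightarrow> H (y, \<tau>) = ennreal (F (y, \<tau>))"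
  shows "ennreal (duhamel_L p F x t) = nn_duhamel p H x t"
proof -
  \<comment> \<open>Cutting \<open>F\<close> to the strip on which it is continuous gives a function
    that is Borel on all of space-time.\<close>
  define G where "G z = indicator (UNIV \<times> {0..t}) z *\<^sub>R F z" for z
  have [measurable]: "G \<in> borel_measurable borel"
    unfolding G_def by (rule borel_measurable_continuous_on_indicator[OF _ cont])
      (auto intro!: borel_closed closed_Times)
  have G_nn: "G z \<ge> 0" for z using nn by (simp add: G_def)
  have G_eq: "G (y, \<tau>) = F (y, \<tau>)" if "\<tau> \<in> {0..t}" for y \<tau> using that by (simp add: G_def)
  have "compact (F ` (cball x t \<times> {0..t}))"
    by (intro compact_continuous_image compact_Times) (auto intro: continuous_on_subset[OF cont])
  then obtain C where C: "\<And>z. z \<in> cball x t \<times> {0..t} \<Longrightarrow> F z \<le> C"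
    by (metis bounded_pos compact_imp_bounded imageI abs_le_D1 real_norm_def)
  have bd: "G (x + (t - \<tau>) *\<^sub>R \<xi>, \<tau>) \<le> C" if "\<tau> \<in> {0..t}" "norm \<xi> \<le> 1" for \<tau> \<xi>
  proof -
    have "norm ((t - \<tau>) *\<^sub>R \<xi>) \<le> t * 1"
      unfolding norm_scaleR using that by (intro mult_mono) auto
    then have "(x + (t - \<tau>) *\<^sub>R \<xi>, \<tau>) \<in> cball x t \<times> {0..t}" using that by (simp add: dist_norm)
    from C[OF this] that show ?thesis by (simp add: G_eq)
  qed
  have slice [measurable]: "(\<lambda>\<xi>. G (x + (t - \<tau>) *\<^sub>R \<xi>, \<tau>)) \<in> borel_measurable borel" for \<tau>
    by measurable
  define D where "D \<tau> = indicator {0..t} \<tau> * ((t - \<tau>) / (1 + \<tau>) powr (p - 1) *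
      disc_integral (\<lambda>\<xi>. G (x + (t - \<tau>) *\<^sub>R \<xi>, \<tau>)))" for \<tau>
  have [measurable]: "D \<in> borel_measurable borel"
    unfolding D_def disc_integral_eq by measurable
  have fac: "0 \<le> (t - \<tau>) / (1 + \<tau>) powr (p - 1)" "(t - \<tau>) / (1 + \<tau>) powr (p - 1) \<le> t" if "\<tau> \<in> {0..t}" for \<tau>
  proof -
    have "(1 + \<tau>) powr (p - 1) \<ge> 1" using that p by (simp add: ge_one_powr_ge_zero)
    then show "0 \<le> (t - \<tau>) / (1 + \<tau>) powr (p - 1)" "(t - \<tau>) / (1 + \<tau>) powr (p - 1) \<le> t"
      using that mult_mono[of t t 1 "(1 + \<tau>) powr (p - 1)"] by (auto simp: divide_le_eq)
  qed
  have D_nn: "0 \<le> D \<tau>" for \<tau>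
    using fac[of \<tau>] disc_integral_nonneg[of "\<lambda>\<xi>. G (x + (t - \<tau>) *\<^sub>R \<xi>, \<tau>)"] G_nn
    by (auto simp: D_def indicator_def)
  have D_le: "D \<tau> \<le> indicator {0..t} \<tau> * (t * (2 * pi * C))" for \<tau>
    using fac[of \<tau>] disc_integral_nonneg[of "\<lambda>\<xi>. G (x + (t - \<tau>) *\<^sub>R \<xi>, \<tau>)"] G_nn
      disc_integral_le[OF slice bd, of \<tau>]
      mult_mono[of "(t - \<tau>) / (1 + \<tau>) powr (p - 1)" t
        "disc_integral (\<lambda>\<xi>. G (x + (t - \<tau>) *\<^sub>R \<xi>, \<tau>))" "2 * pi * C"]
    by (auto simp: D_def indicator_def)
  have "integrable lborel D"
  proof (rule Bochner_Integration.integrable_bound)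
    show "integrable lborel (\<lambda>\<tau>. indicator {0..t} \<tau> * (t * (2 * pi * C)))"
      by (intro integrable_mult_left integrable_real_indicator) (simp_all add: emeasure_lborel_Icc_eq)
    show "AE \<tau> in lborel. norm (D \<tau>) \<le> norm (indicator {0..t} \<tau> * (t * (2 * pi * C)))"
      using D_nn D_le by (intro AE_I2) (auto intro: order_trans[OF _ abs_ge_self])
  qed measurable
  then have 1: "ennreal (LINT \<tau>|lborel. D \<tau>) = (\<integral>\<^sup>+\<tau>. ennreal (D \<tau>) \<partial>lborel)"
    using D_nn by (simp add: nn_integral_eq_integral)
  have eq: "(LINT \<tau>|lborel. D \<tau>) = (LINT \<tau>:{0..t}|lborel.
        (t - \<tau>) / (1 + \<tau>) powr (p - 1) * disc_integral (\<lambda>\<xi>. F (x + (t - \<tau>) *\<^sub>R \<xi>, \<tau>)))"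
    unfolding set_lebesgue_integral_def D_def
    by (intro Bochner_Integration.integral_cong) (auto simp: indicator_def G_eq)
  have "ennreal (duhamel_L p F x t) = ennreal (1 / (2 * pi) * (LINT \<tau>|lborel. D \<tau>))"
    by (simp only: duhamel_L_def eq)
  also have "\<dots> = ennreal (1 / (2 * pi)) * ennreal (LINT \<tau>|lborel. D \<tau>)"
    by (rule ennreal_mult) (auto intro!: Bochner_Integration.integral_nonneg D_nn)
  also have "\<dots> = nn_duhamel p H x t"
    unfolding nn_duhamel_def 1
  proof (intro arg_cong2[of _ _ _ _ "(*)"] refl nn_integral_cong)
    fix \<tau> :: real
    show "ennreal (D \<tau>) = ennreal ((t - \<tau>) / (1 + \<tau>) powr (p - 1)) * indicator {0..t} \<tau> *
        (\<integral>\<^sup>+\<xi>. ennreal (disc_weight \<xi>) * H (x + (t - \<tau>) *\<^sub>R \<xi>, \<tau>) \<partial>lborel)"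
    proof (cases "\<tau> \<in> {0..t}")
      case True
      have "(\<integral>\<^sup>+\<xi>. ennreal (disc_weight \<xi>) * H (x + (t - \<tau>) *\<^sub>R \<xi>, \<tau>) \<partial>lborel) =
         ennreal (disc_integral (\<lambda>\<xi>. G (x + (t - \<tau>) *\<^sub>R \<xi>, \<tau>)))"
        using True by (subst ennreal_disc_integral[OF slice bd G_nn]) (auto simp: H G_eq)
      then show ?thesis
        using True ennreal_mult[OF fac(1)[OF True] disc_integral_nonneg[OF G_nn]] unfolding D_def by simp
    qed (simp add: D_def)
  qed
  finally show ?thesis .
qed

text \<open>The truncated cone widens at unit speed: with \<open>b = \<tau> - l\<close> and
  \<open>r = t - \<tau>\<close> the larger radius \<open>b + r\<close> is \<open>t - l\<close>. The
  mean over discs therefore loses no mass, and Tonelli moves the time integral outside.\<close>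

lemma nn_integral_nn_duhamel_ge:
  assumes [measurable]: "H \<in> borel_measurable borel"
  shows "(\<integral>\<^sup>+\<tau>. ennreal ((t - \<tau>) / (1 + \<tau>) powr (p - 1)) * indicator {0..t} \<tau> *
        (\<integral>\<^sup>+y. H (y, \<tau>) * indicator (cball 0 (\<tau> - l)) y \<partial>lborel) \<partial>lborel)
    \<le> (\<integral>\<^sup>+x. nn_duhamel p H x t * indicator (cball 0 (t - l)) x \<partial>lborel)"
proof -
  let ?c = "\<lambda>\<tau>. ennreal ((t - \<tau>) / (1 + \<tau>) powr (p - 1)) * indicator {0..t} \<tau>"
  let ?M = "\<lambda>x \<tau>. \<integral>\<^sup>+\<xi>. ennreal (disc_weight \<xi>) * H (x + (t - \<tau>) *\<^sub>R \<xi>, \<tau>) \<partial>lborel"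
  have one: "ennreal (1 / (2 * pi)) * ennreal (2 * pi) = 1"
    by (subst ennreal_mult[symmetric]) auto
  have [measurable]: "(\<lambda>y. H (y, \<tau>)) \<in> borel_measurable borel" for \<tau> by measurable
  have "(\<integral>\<^sup>+\<tau>. ?c \<tau> * (\<integral>\<^sup>+y. H (y, \<tau>) * indicator (cball 0 (\<tau> - l)) y \<partial>lborel) \<partial>lborel) =
     (\<integral>\<^sup>+\<tau>. ennreal (1 / (2 * pi)) * (?c \<tau> * (ennreal (2 * pi) * (\<integral>\<^sup>+y. H (y, \<tau>) * indicator (cball 0 (\<tau> - l)) y \<partial>lborel))) \<partial>lborel)"
  proof (intro nn_integral_cong)
    fix \<tau>
    have "a * (b * (c * d)) = (a * c) * (b * d)" for a b c d :: ennreal by (simp only: mult_ac)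
    then show "?c \<tau> * (\<integral>\<^sup>+y. H (y, \<tau>) * indicator (cball 0 (\<tau> - l)) y \<partial>lborel) =
      ennreal (1 / (2 * pi)) * (?c \<tau> * (ennreal (2 * pi) * (\<integral>\<^sup>+y. H (y, \<tau>) * indicator (cball 0 (\<tau> - l)) y \<partial>lborel)))"
      by (simp only: one mult_1_left)
  qed
  also have "\<dots> \<le> (\<integral>\<^sup>+\<tau>. ennreal (1 / (2 * pi)) * (?c \<tau> * (\<integral>\<^sup>+x. ?M x \<tau> * indicator (cball 0 (t - l)) x \<partial>lborel)) \<partial>lborel)"
  proof (rule nn_integral_mono)
    fix \<tau>
    show "ennreal (1 / (2 * pi)) * (?c \<tau> * (ennreal (2 * pi) * (\<integral>\<^sup>+y. H (y, \<tau>) * indicator (cball 0 (\<tau> - l)) y \<partial>lborel)))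
      \<le> ennreal (1 / (2 * pi)) * (?c \<tau> * (\<integral>\<^sup>+x. ?M x \<tau> * indicator (cball 0 (t - l)) x \<partial>lborel))"
    proof (cases "\<tau> \<in> {0..t}")
      case True
      then have "ennreal (2 * pi) * (\<integral>\<^sup>+y. H (y, \<tau>) * indicator (cball 0 (\<tau> - l)) y \<partial>lborel) \<le>
         (\<integral>\<^sup>+x. ?M x \<tau> * indicator (cball 0 (t - l)) x \<partial>lborel)"
        using nn_integral_spherical_mean_ge[of "\<lambda>y. H (y, \<tau>)" "t - \<tau>" "\<tau> - l"] by simp
      then show ?thesis by (intro mult_left_mono) auto
    qed simp
  qed
  also have "\<dots> = (\<integral>\<^sup>+\<tau>. (\<integral>\<^sup>+x. ennreal (1 / (2 * pi)) * (?c \<tau> * (?M x \<tau> * indicator (cball 0 (t - l)) x)) \<partial>lborel) \<partial>lborel)"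
    by (intro nn_integral_cong) (simp add: nn_integral_cmult)
  also have "\<dots> = (\<integral>\<^sup>+x. (\<integral>\<^sup>+\<tau>. ennreal (1 / (2 * pi)) * (?c \<tau> * (?M x \<tau> * indicator (cball 0 (t - l)) x)) \<partial>lborel) \<partial>lborel)"
    by (rule lborel_pair.Fubini') measurable
  also have "\<dots> = (\<integral>\<^sup>+x. nn_duhamel p H x t * indicator (cball 0 (t - l)) x \<partial>lborel)"
    unfolding nn_duhamel_def
    by (intro nn_integral_cong) (simp add: nn_integral_cmult split: split_indicator)
  finally show ?thesis .
qed

text \<open>The reverse triangle inequality of Minkowski space, between the points \<open>(\<tau>, y)\<close>
  and \<open>(t - \<tau>, x - y)\<close> of the forward light cone. The inequality between \<open>2 \<tau>\<close> and \<open>t - |x|\<close>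
  is strict because \<open>wave_kernel r\<close> takes the junk value \<open>0\<close> on the circle of radius \<open>r\<close>.\<close>

lemma wave_kernel_ge:
  fixes x y :: "real^2"
  assumes "norm y \<le> \<tau>" "2 * \<tau> < t - norm x"
  shows "wave_kernel (t - \<tau>) (y - x) \<ge> 1 / sqrt (t\<^sup>2 - (norm x)\<^sup>2)"
proof -
  have \<tau>: "0 \<le> \<tau>" using assms(1) norm_ge_zero[of y] by linarith
  have d: "norm (y - x) < t - \<tau>" using assms norm_triangle_ineq4[of y x] by linarith
  have pos: "0 < (t - \<tau>)\<^sup>2 - (norm (y - x))\<^sup>2"
    using d by (simp add: power_strict_mono)
  \<comment> \<open>Expanding, \<open>(t - norm y)\<^sup>2 - (norm (y - x))\<^sup>2\<close> equals
    \<open>t\<^sup>2 - (norm x)\<^sup>2\<close> minus twice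
    \<open>norm y * t - y \<bullet> x\<close>, which is nonnegative by Cauchy-Schwarz.\<close>
  have "(norm (y - x))\<^sup>2 = (norm y)\<^sup>2 + (norm x)\<^sup>2 - 2 * (y \<bullet> x)"
    by (simp add: power2_norm_eq_inner inner_diff inner_commute)
  moreover have "y \<bullet> x \<le> norm y * t"
    using norm_cauchy_schwarz[of y x] mult_left_mono[of "norm x" t "norm y"] assms \<tau> by simp
  moreover have "(t - \<tau>)\<^sup>2 \<le> (t - norm y)\<^sup>2"
    using assms \<tau> norm_ge_zero[of x] by (intro power_mono) linarith+
  ultimately have le: "(t - \<tau>)\<^sup>2 - (norm (y - x))\<^sup>2 \<le> t\<^sup>2 - (norm x)\<^sup>2"
    by (simp add: power2_diff algebra_simps)
  from le pos d show ?thesis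
    by (auto simp: wave_kernel_def indicator_def intro!: divide_left_mono)
qed

text \<open>The factor \<open>t - \<tau>\<close> of Duhamel's integral converts the disc mean into
  an integral against \<open>wave_kernel (t - \<tau>)\<close>. By \<open>wave_kernel_ge\<close> this
  kernel is bounded below by a quantity independent of source point and source time, which can be
  pulled out.\<close>

lemma nn_duhamel_ge_kernel:
  fixes x :: "real^2"
  assumes [measurable]: "H \<in> borel_measurable borel" and x: "norm x < t"
  shows "nn_duhamel p H x t \<ge> ennreal (1 / (2 * pi * sqrt (t\<^sup>2 - (norm x)\<^sup>2))) *
    (\<integral>\<^sup>+\<tau>. ennreal (1 / (1 + \<tau>) powr (p - 1)) * indicator {0..<(t - norm x) / 2} \<tau> *
        (\<integral>\<^sup>+y. H (y, \<tau>) * indicator (cball 0 \<tau>) y \<partial>lborel) \<partial>lborel)"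
proof -
  let ?s = "1 / sqrt (t\<^sup>2 - (norm x)\<^sup>2)"
  let ?I = "\<lambda>\<tau>. \<integral>\<^sup>+y. H (y, \<tau>) * indicator (cball 0 \<tau>) y \<partial>lborel"
  have sp: "?s \<ge> 0" using x by (simp add: power_mono)
  have [measurable]: "(\<lambda>y. H (y, \<tau>)) \<in> borel_measurable borel" for \<tau> by measurable
  have [measurable]: "Measurable.pred (borel \<Otimes>\<^sub>M borel) (\<lambda>z. fst z \<in> cball (0::real^2) (snd z))"
    by simp
  have "ennreal (1 / (2 * pi * sqrt (t\<^sup>2 - (norm x)\<^sup>2))) *
      (\<integral>\<^sup>+\<tau>. ennreal (1 / (1 + \<tau>) powr (p - 1)) * indicator {0..<(t - norm x) / 2} \<tau> * ?I \<tau> \<partial>lborel)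
    = ennreal (1 / (2 * pi)) * (ennreal ?s *
      (\<integral>\<^sup>+\<tau>. ennreal (1 / (1 + \<tau>) powr (p - 1)) * indicator {0..<(t - norm x) / 2} \<tau> * ?I \<tau> \<partial>lborel))"
    using sp by (simp add: mult.assoc[symmetric] ennreal_mult[symmetric])
  also have "\<dots> = ennreal (1 / (2 * pi)) *
      (\<integral>\<^sup>+\<tau>. ennreal ?s * (ennreal (1 / (1 + \<tau>) powr (p - 1)) * indicator {0..<(t - norm x) / 2} \<tau> * ?I \<tau>) \<partial>lborel)"
    by (subst nn_integral_cmult) (auto simp: indicator_def intro!: measurable_If)
  also have "\<dots> \<le> nn_duhamel p H x t"
    unfolding nn_duhamel_def
  proof (intro mult_left_mono nn_integral_mono)
    fix \<tau>
    show "ennreal ?s * (ennreal (1 / (1 + \<tau>) powr (p - 1)) * indicator {0..<(t - norm x) / 2} \<tau> * ?I \<tau>)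
      \<le> ennreal ((t - \<tau>) / (1 + \<tau>) powr (p - 1)) * indicator {0..t} \<tau> *
        (\<integral>\<^sup>+\<xi>. ennreal (disc_weight \<xi>) * H (x + (t - \<tau>) *\<^sub>R \<xi>, \<tau>) \<partial>lborel)"
    proof (cases "\<tau> \<in> {0..<(t - norm x) / 2}")
      case True
      then have \<tau>: "0 \<le> \<tau>" "2 * \<tau> < t - norm x" by auto
      then have lt: "\<tau> < t" using norm_ge_zero[of x] by linarith
      have "ennreal ?s * ?I \<tau> = (\<integral>\<^sup>+y. ennreal ?s * (H (y, \<tau>) * indicator (cball 0 \<tau>) y) \<partial>lborel)"
        by (simp add: nn_integral_cmult)
      also have "\<dots> \<le> (\<integral>\<^sup>+y. ennreal (wave_kernel (t - \<tau>) (y - x)) * H (y, \<tau>) \<partial>lborel)"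
      proof (rule nn_integral_mono)
        fix y
        show "ennreal ?s * (H (y, \<tau>) * indicator (cball 0 \<tau>) y) \<le> ennreal (wave_kernel (t - \<tau>) (y - x)) * H (y, \<tau>)"
          using wave_kernel_ge[of y \<tau> t x] \<tau>
          by (cases "norm y \<le> \<tau>") (auto intro!: mult_right_mono ennreal_leI)
      qed
      also have "\<dots> = ennreal (t - \<tau>) * (\<integral>\<^sup>+\<xi>. ennreal (disc_weight \<xi>) * H (x + (t - \<tau>) *\<^sub>R \<xi>, \<tau>) \<partial>lborel)"
        using lt nn_integral_disc_weight_eq_kernel[of "\<lambda>y. H (y, \<tau>)" "t - \<tau>" x] by simp
      finally have "ennreal (1 / (1 + \<tau>) powr (p - 1)) * (ennreal ?s * ?I \<tau>) \<le>
         ennreal (1 / (1 + \<tau>) powr (p - 1)) * (ennreal (t - \<tau>) * (\<integral>\<^sup>+\<xi>. ennreal (disc_weight \<xi>) * H (x + (t - \<tau>) *\<^sub>R \<xi>, \<tau>) \<partial>lborel))"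
        by (rule mult_left_mono) simp
      moreover have "ennreal ((t - \<tau>) / (1 + \<tau>) powr (p - 1)) = ennreal (1 / (1 + \<tau>) powr (p - 1)) * ennreal (t - \<tau>)"
        using lt by (subst ennreal_mult[symmetric]) auto
      ultimately show ?thesis
        using True lt by (simp add: mult_ac)
    qed simp
  qed simp_all
  finally show ?thesis .
qed

section \<open>Blow-up of positive supersolutions\<close>

text \<open>If \<open>V \<ge> a\<close>, waiting for a time of order
  \<open>a powr ((1 - p) / 2)\<close> raises the bound to \<open>2 * a\<close>. These waiting times
  form a geometric series whose sum is less than \<open>t\<^sub>0\<close>; at the limit time all the
  bounds hold at once.\<close>

lemma kato_blowup:
  fixes V :: "real \<Rightarrow> ennreal"
  assumes p: "1 < p" and A: "A > 0" and K: "K > 0" and t\<^sub>0: "t\<^sub>0 > 0"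
    and base: "\<And>t. t\<^sub>0 \<le> t \<Longrightarrow> t < 2 * t\<^sub>0 \<Longrightarrow> V t \<ge> ennreal A"
    and step: "\<And>a s t. a > 0 \<Longrightarrow> t\<^sub>0 \<le> s \<Longrightarrow> s \<le> t \<Longrightarrow> t < 2 * t\<^sub>0 \<Longrightarrow>
      (\<And>\<tau>. s \<le> \<tau> \<Longrightarrow> \<tau> \<le> t \<Longrightarrow> V \<tau> \<ge> ennreal a) \<Longrightarrow> V t \<ge> ennreal (K * a powr p * (t - s)\<^sup>2)"
    and big: "2 * A powr (1 - p) / K < (t\<^sub>0 * (1 - sqrt (2 powr (1 - p))))\<^sup>2"
  shows "\<exists>t. t\<^sub>0 \<le> t \<and> t < 2 * t\<^sub>0 \<and> V t = \<infinity>"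
proof -
  \<comment> \<open>Doubling the level multiplies the waiting time by \<open>q\<close>.\<close>
  define q where "q = sqrt (2 powr (1 - p))"
  have q: "0 < q" "q < 1"
  proof -
    have "(2::real) powr (1 - p) < 2 powr 0" using p by (intro powr_less_mono) auto
    then show "0 < q" "q < 1" by (auto simp: q_def)
  qed
  \<comment> \<open>The first waiting time, the solution of
    \<open>K * A powr p * h\<^sup>2 = 2 * A\<close>.\<close>
  define h where "h = sqrt (2 * A powr (1 - p) / K)"
  have h: "h > 0" using A K by (simp add: h_def)
  \<comment> \<open>The hypothesis \<open>big\<close> says that the total waiting time
    \<open>h / (1 - q)\<close> fits into an interval of length \<open>t\<^sub>0\<close>.\<close>
  have "h < t\<^sub>0 * (1 - q)"
    using big q t\<^sub>0 unfolding h_def q_def by (intro real_less_lsqrt) auto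
  then have hq: "h / (1 - q) < t\<^sub>0" using q by (simp add: divide_less_eq)
  define c where "c = h / (1 - q)"
  have c: "c > 0" "c < t\<^sub>0" "c * (1 - q) = h" using hq h q by (simp_all add: c_def)
  define \<sigma> where "\<sigma> j = t\<^sub>0 + c * (1 - q ^ j)" for j :: nat
  have \<sigma>_step: "\<sigma> (Suc j) - \<sigma> j = h * q ^ j" for j
    unfolding c(3)[symmetric] by (simp add: \<sigma>_def algebra_simps)
  have \<sigma>_ge: "t\<^sub>0 \<le> \<sigma> j" for j
    using c q by (auto simp: \<sigma>_def power_le_one)
  have growth: "V t \<ge> ennreal (A * 2 ^ j)" if "\<sigma> j \<le> t" "t < 2 * t\<^sub>0" for j t
    using that
  proof (induction j arbitrary: t)
    case 0
    then show ?case using base[of t] \<sigma>_ge[of 0] by (simp add: \<sigma>_def)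
  next
    case (Suc j)
    have le: "h * q ^ j \<le> t - \<sigma> j" using \<sigma>_step[of j] Suc.prems by linarith
    have hqj: "h * q ^ j > 0" using h q by simp
    let ?a = "A * 2 ^ j"
    have "V t \<ge> ennreal (K * ?a powr p * (t - \<sigma> j)\<^sup>2)"
      using Suc.prems Suc.IH le hqj \<sigma>_ge A by (intro step) auto
    moreover have "K * ?a powr p * (t - \<sigma> j)\<^sup>2 \<ge> K * ?a powr p * (h * q ^ j)\<^sup>2"
      using le hqj K by (intro mult_left_mono power_mono) auto
    moreover have "K * ?a powr p * (h * q ^ j)\<^sup>2 = A * 2 ^ Suc j"
    proof -
      have "h\<^sup>2 = 2 * A powr (1 - p) / K" using A K by (simp add: h_def)
      moreover have "(q ^ j)\<^sup>2 = (2 ^ j) powr (1 - p)"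
      proof -
        have "(q ^ j)\<^sup>2 = (q\<^sup>2) ^ j" by (simp add: power_mult[symmetric] mult.commute)
        also have "\<dots> = (2 powr (1 - p)) ^ j" by (simp add: q_def)
        also have "\<dots> = (2 ^ j) powr (1 - p)"
          by (simp add: powr_realpow[symmetric] powr_powr mult.commute)
        finally show ?thesis .
      qed
      ultimately have "K * ?a powr p * (h * q ^ j)\<^sup>2 = 2 * (?a powr p * ?a powr (1 - p))"
        using A K by (simp add: power_mult_distrib powr_mult)
      also have "\<dots> = 2 * ?a" using A by (simp add: powr_add[symmetric])
      finally show ?thesis by simp
    qed
    ultimately show ?case by (metis ennreal_leI order_trans)
  qed
  define t where "t = t\<^sub>0 + c"
  have t: "t\<^sub>0 \<le> t" "t < 2 * t\<^sub>0" using c by (auto simp: t_def)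
  have \<sigma>t: "\<sigma> j \<le> t" for j
    using c q by (auto simp: \<sigma>_def t_def intro!: mult_left_le)
  have "V t = \<infinity>"
  proof (rule ccontr)
    assume "V t \<noteq> \<infinity>"
    then obtain v where v: "V t = ennreal v" "v \<ge> 0" by (cases "V t") auto
    obtain j where "v / A < 2 ^ j" using real_arch_pow[of 2 "v / A"] by auto
    then have "v < A * 2 ^ j" using A by (simp add: divide_less_eq mult.commute)
    moreover have "A * 2 ^ j \<le> v" using growth[OF \<sigma>t t(2), of j] v by (simp add: ennreal_le_iff)
    ultimately show False by simp
  qed
  with t show ?thesis by blast
qed

text \<open>A substitute for Jensen's inequality, from the pointwise bound \<open>b powr (p - 1) * v \<le> v powr p + b powr p\<close>.\<close>

lemma nn_integral_powr_ge:
  assumes p: "1 < p" and a: "a > 0" and \<beta>: "\<beta> > 0"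
    and [measurable]: "v \<in> borel_measurable M" "B \<in> sets M"
    and V: "ennreal a \<le> (\<integral>\<^sup>+y. ennreal (v y) * indicator B y \<partial>M)"
    and B: "emeasure M B \<le> ennreal \<beta>"
  shows "ennreal ((a / (2 * \<beta>)) powr (p - 1) * (a / 2)) \<le> (\<integral>\<^sup>+y. ennreal (\<bar>v y\<bar> powr p) * indicator B y \<partial>M)"
    (is "_ \<le> ?N")
proof -
  \<comment> \<open>With this threshold the error term \<open>b powr p * \<beta>\<close> is exactly
    half of the main term \<open>b powr (p - 1) * a\<close>.\<close>
  define b where "b = a / (2 * \<beta>)"
  have b: "b > 0" using a \<beta> by (simp add: b_def)
  have bp: "b powr p = b powr (p - 1) * b" using b powr_add[of b "p - 1" 1] by simp
  have pt: "ennreal (b powr (p - 1)) * ennreal (v y) \<le> ennreal (\<bar>v y\<bar> powr p) + ennreal (b powr p)" for y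
  proof (cases "v y \<ge> b")
    case True
    have "b powr (p - 1) * v y \<le> v y powr (p - 1) * v y"
      using True b p by (intro mult_right_mono powr_mono2) auto
    also have "\<dots> = \<bar>v y\<bar> powr p" using True b powr_add[of "v y" "p - 1" 1] by simp
    finally show ?thesis using True b by (simp add: ennreal_mult[symmetric] ennreal_leI add_increasing2)
  next
    case False
    have "ennreal (b powr (p - 1)) * ennreal (v y) \<le> ennreal (b powr (p - 1)) * ennreal b"
      using False by (intro mult_left_mono ennreal_leI) auto
    then show ?thesis using b by (simp add: ennreal_mult[symmetric] bp add_increasing)
  qed
  have "ennreal (b powr (p - 1)) * ennreal a \<le> ennreal (b powr (p - 1)) * (\<integral>\<^sup>+y. ennreal (v y) * indicator B y \<partial>M)"
    by (intro mult_left_mono V) simp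
  also have "\<dots> = (\<integral>\<^sup>+y. ennreal (b powr (p - 1)) * (ennreal (v y) * indicator B y) \<partial>M)"
    by (simp add: nn_integral_cmult)
  also have "\<dots> \<le> (\<integral>\<^sup>+y. ennreal (\<bar>v y\<bar> powr p) * indicator B y + ennreal (b powr p) * indicator B y \<partial>M)"
    using pt by (intro nn_integral_mono) (auto split: split_indicator)
  also have "\<dots> = ?N + ennreal (b powr p) * emeasure M B"
    by (subst nn_integral_add) (simp_all add: nn_integral_cmult)
  also have "\<dots> \<le> ?N + ennreal (b powr p) * ennreal \<beta>"
    by (intro add_left_mono mult_left_mono B) simp
  finally have *: "ennreal (b powr (p - 1) * a) \<le> ?N + ennreal (b powr p * \<beta>)"
    using a \<beta> by (simp add: ennreal_mult)
  have eq: "b powr p * \<beta> = b powr (p - 1) * (a / 2)" using \<beta> by (simp add: bp) (simp add: b_def)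
  show ?thesis
  proof (cases ?N)
    case (real n)
    have "b powr (p - 1) * a \<le> n + b powr p * \<beta>"
      using * real \<beta>
      by (simp add: ennreal_plus[symmetric] ennreal_le_iff del: ennreal_plus)
    then show ?thesis unfolding real(2) using eq by (intro ennreal_leI) (simp add: b_def[symmetric])
  qed simp
qed

lemma nn_integral_linear_ramp:
  "s \<le> t \<Longrightarrow> (\<integral>\<^sup>+\<tau>. ennreal (t - \<tau>) * indicator {s..t} \<tau> \<partial>lborel) = ennreal ((t - s)\<^sup>2 / 2)"
proof -
  assume "s \<le> t"
  then have "(\<integral>\<^sup>+\<tau>. ennreal (t - \<tau>) * indicator {s..t} \<tau> \<partial>lborel) = ennreal (- (t - t)\<^sup>2 / 2 - (- (t - s)\<^sup>2 / 2))"
    by (intro nn_integral_FTC_Icc) (auto intro!: derivative_eq_intros simp: field_simps)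
  then show ?thesis by simp
qed

lemma nn_integral_inverse_Icc:
  "0 < a \<Longrightarrow> a \<le> b \<Longrightarrow> (\<integral>\<^sup>+\<tau>. ennreal (1 / \<tau>) * indicator {a..b} \<tau> \<partial>lborel) = ennreal (ln (b / a))"
proof -
  assume "0 < a" "a \<le> b"
  then have "(\<integral>\<^sup>+\<tau>. ennreal (1 / \<tau>) * indicator {a..b} \<tau> \<partial>lborel) = ennreal (ln b - ln a)"
    by (intro nn_integral_FTC_Icc) (auto intro!: derivative_eq_intros)
  with \<open>0 < a\<close> \<open>a \<le> b\<close> show ?thesis by (simp add: ln_div)
qed

section \<open>Mass and source mass of a supersolution in the truncated cone\<close>

locale supersolution =
  fixes p T l :: real and u :: "(real^2) \<times> real \<Rightarrow> real"
  assumes p: "1 < p" and T: "0 < T"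
    and cont: "continuous_on (space_time T) u"
    and super: "\<And>x t. 0 \<le> t \<Longrightarrow> t < T \<Longrightarrow> norm x \<le> t - l \<Longrightarrow>
      duhamel_L p (\<lambda>z. \<bar>u z\<bar> powr p) x t \<le> u (x, t)"
begin

text \<open>Nothing is known of \<open>u\<close> outside the strip, so it is replaced by 0 there to
  make the source Borel on all of space-time.\<close>

definition source :: "(real^2) \<times> real \<Rightarrow> ennreal" where
  "source z = ennreal (\<bar>indicator (space_time T) z *\<^sub>R u z\<bar> powr p)"

text \<open>For \<open>0 \<le> t < T\<close> the coercion \<open>ennreal\<close> truncates nothing
  here: \<open>super\<close> and \<open>duhamel_L_nonneg\<close> make \<open>u\<close> nonnegative
  in the cone.\<close>

definition mass :: "real \<Rightarrow> ennreal" where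
  "mass t = (\<integral>\<^sup>+x. ennreal (u (x, t)) * indicator (cball 0 (t - l)) x \<partial>lborel)"

definition source_mass :: "real \<Rightarrow> ennreal" where
  "source_mass t = (\<integral>\<^sup>+y. source (y, t) * indicator (cball 0 (t - l)) y \<partial>lborel)"

lemma source_measurable [measurable]: "source \<in> borel_measurable borel"
proof -
  have [measurable]: "(\<lambda>z. indicator (space_time T) z *\<^sub>R u z) \<in> borel_measurable borel"
    by (rule borel_measurable_continuous_on_indicator[OF _ cont])
       (simp add: space_time_def borel_prod[symmetric])
  show ?thesis unfolding source_def by measurable
qed

lemma source_slice_measurable [measurable]: "(\<lambda>y. source (y, t)) \<in> borel_measurable borel"
  by measurable

lemma source_eq: "0 \<le> t \<Longrightarrow> t < T \<Longrightarrow> source (y, t) = ennreal (\<bar>u (y, t)\<bar> powr p)"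
  by (simp add: source_def space_time_def)

lemma source_mass_measurable [measurable]: "source_mass \<in> borel_measurable borel"
proof -
  have [measurable]: "Measurable.pred (borel \<Otimes>\<^sub>M borel) (\<lambda>z. snd z \<in> cball (0::real^2) (fst z - l))"
    by simp
  show ?thesis
    unfolding source_mass_def by measurable
qed

lemma slice_continuous: "0 \<le> t \<Longrightarrow> t < T \<Longrightarrow> continuous_on UNIV (\<lambda>x. u (x, t))"
  by (rule continuous_on_compose2[OF cont]) (auto intro!: continuous_intros simp: space_time_def)

lemma slice_measurable: "0 \<le> t \<Longrightarrow> t < T \<Longrightarrow> (\<lambda>x. u (x, t)) \<in> borel_measurable borel"
  by (intro borel_measurable_continuous_onI slice_continuous)

lemma ennreal_duhamel_source:
  assumes "0 \<le> t" "t < T"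
  shows "ennreal (duhamel_L p (\<lambda>z. \<bar>u z\<bar> powr p) x t) = nn_duhamel p source x t"
proof (rule ennreal_duhamel_L)
  show "continuous_on (UNIV \<times> {0..t}) (\<lambda>z. \<bar>u z\<bar> powr p)"
    using p assms by (intro continuous_on_powr' continuous_intros continuous_on_subset[OF cont])
      (auto simp: space_time_def)
qed (use p assms in \<open>auto simp: source_eq\<close>)

lemma nn_duhamel_source_le:
  "0 \<le> t \<Longrightarrow> t < T \<Longrightarrow> norm x \<le> t - l \<Longrightarrow> nn_duhamel p source x t \<le> ennreal (u (x, t))"
  using super[of t x] ennreal_duhamel_source[of t x] by (metis ennreal_leI)

text \<open>The fact that the blow-up contradicts: a continuous function is bounded on a compact
  ball.\<close>

lemma mass_finite:
  assumes "0 \<le> t" "t < T"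
  shows "mass t < \<infinity>"
proof -
  have "compact ((\<lambda>x. u (x, t)) ` cball 0 (t - l))"
    by (intro compact_continuous_image continuous_on_subset[OF slice_continuous[OF assms]]) auto
  then obtain C where C: "\<And>x. x \<in> cball 0 (t - l) \<Longrightarrow> u (x, t) \<le> C"
    by (metis (mono_tags, lifting) bounded_pos compact_imp_bounded imageI abs_le_D1 real_norm_def)
  have "mass t \<le> (\<integral>\<^sup>+x. ennreal C * indicator (cball (0::real^2) (t - l)) x \<partial>lborel)"
    unfolding mass_def using C by (intro nn_integral_mono) (auto intro!: ennreal_leI split: split_indicator)
  also have "\<dots> = ennreal C * emeasure lborel (cball (0::real^2) (t - l))"
    by (simp add: nn_integral_cmult)
  also have "\<dots> < \<infinity>"
    using emeasure_bounded_finite[of "cball (0::real^2) (t - l)"] by (simp add: ennreal_mult_less_top)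
  finally show ?thesis .
qed

lemma mass_ge:
  assumes "0 \<le> t" "t < T"
  shows "(\<integral>\<^sup>+\<tau>. ennreal ((t - \<tau>) / (1 + \<tau>) powr (p - 1)) * indicator {0..t} \<tau> * source_mass \<tau> \<partial>lborel) \<le> mass t"
proof -
  have "(\<integral>\<^sup>+x. nn_duhamel p source x t * indicator (cball 0 (t - l)) x \<partial>lborel) \<le> mass t"
    unfolding mass_def using nn_duhamel_source_le[OF assms]
    by (intro nn_integral_mono) (auto split: split_indicator)
  with nn_integral_nn_duhamel_ge[of source t p l] show ?thesis
    unfolding source_mass_def by (auto intro: order_trans)
qed

lemma source_mass_ge:
  assumes "0 \<le> t" "t < T" "a > 0" "\<beta> > 0" "pi * (t - l)\<^sup>2 \<le> \<beta>" "ennreal a \<le> mass t"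
  shows "ennreal ((a / (2 * \<beta>)) powr (p - 1) * (a / 2)) \<le> source_mass t"
proof -
  have "emeasure lborel (cball (0::real^2) (t - l)) \<le> ennreal \<beta>"
  proof (cases "t \<ge> l")
    case True
    then show ?thesis using assms by (simp add: emeasure_cball_2 ennreal_leI)
  qed simp
  from nn_integral_powr_ge[OF p assms(3,4) _ _ _ this, of "\<lambda>x. u (x, t)"] assms slice_measurable[OF assms(1,2)]
  show ?thesis by (simp add: source_mass_def mass_def source_eq)
qed

text \<open>The constant is a product of three factors: the source mass is at least
  \<open>(a / (2 * \<beta>)) powr (p - 1) * (a / 2)\<close>, the weight
  \<open>(1 + \<tau>) powr (1 - p)\<close> at least \<open>(1 + T) powr (1 - p)\<close>, and the
  ramp \<open>t - \<tau>\<close> integrates to \<open>(t - s)\<^sup>2 / 2\<close>.\<close>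

lemma mass_step:
  assumes st: "0 \<le> s" "s \<le> t" "t < T" and a: "a > 0" and \<beta>: "\<beta> > 0" "\<And>\<tau>. s \<le> \<tau> \<Longrightarrow> \<tau> \<le> t \<Longrightarrow> pi * (\<tau> - l)\<^sup>2 \<le> \<beta>"
    and V: "\<And>\<tau>. s \<le> \<tau> \<Longrightarrow> \<tau> \<le> t \<Longrightarrow> ennreal a \<le> mass \<tau>"
  shows "ennreal (1 / (4 * (2 * \<beta> * (1 + T)) powr (p - 1)) * a powr p * (t - s)\<^sup>2) \<le> mass t"
proof -
  define c where "c = (a / (2 * \<beta>)) powr (p - 1) * (a / 2)"
  have c: "c \<ge> 0" using a by (simp add: c_def)
  let ?k = "c / (1 + T) powr (p - 1)"
  have k: "?k \<ge> 0" using c by simp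
  have "1 / (4 * (2 * \<beta> * (1 + T)) powr (p - 1)) * a powr p * (t - s)\<^sup>2 = ?k * ((t - s)\<^sup>2 / 2)"
    using a \<beta> T powr_add[of a "p - 1" 1] by (simp add: c_def powr_mult powr_divide)
  also have "ennreal \<dots> = ennreal ?k * (\<integral>\<^sup>+\<tau>. ennreal (t - \<tau>) * indicator {s..t} \<tau> \<partial>lborel)"
    unfolding nn_integral_linear_ramp[OF st(2)] using k by (intro ennreal_mult) auto
  also have "\<dots> = (\<integral>\<^sup>+\<tau>. ennreal ?k * (ennreal (t - \<tau>) * indicator {s..t} \<tau>) \<partial>lborel)"
    by (simp add: nn_integral_cmult)
  also have "\<dots> \<le> (\<integral>\<^sup>+\<tau>. ennreal ((t - \<tau>) / (1 + \<tau>) powr (p - 1)) * indicator {0..t} \<tau> * source_mass \<tau> \<partial>lborel)"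
  proof (rule nn_integral_mono)
    fix \<tau>
    show "ennreal ?k * (ennreal (t - \<tau>) * indicator {s..t} \<tau>) \<le>
       ennreal ((t - \<tau>) / (1 + \<tau>) powr (p - 1)) * indicator {0..t} \<tau> * source_mass \<tau>"
    proof (cases "\<tau> \<in> {s..t}")
      case True
      then have \<tau>: "0 \<le> \<tau>" "\<tau> < T" "s \<le> \<tau>" "\<tau> \<le> t" using st by auto
      have "?k * (t - \<tau>) \<le> (t - \<tau>) / (1 + \<tau>) powr (p - 1) * c"
        using \<tau> T c p by (auto simp: mult.commute intro!: divide_left_mono powr_mono2 mult_nonneg_nonneg)
      then have "ennreal ?k * ennreal (t - \<tau>) \<le> ennreal ((t - \<tau>) / (1 + \<tau>) powr (p - 1)) * ennreal c"
        using k c \<tau> by (subst (1 2) ennreal_mult[symmetric]) (auto intro: ennreal_leI)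
      also have "\<dots> \<le> ennreal ((t - \<tau>) / (1 + \<tau>) powr (p - 1)) * source_mass \<tau>"
        unfolding c_def using \<tau> a \<beta> V by (intro mult_left_mono source_mass_ge) auto
      finally show ?thesis using True \<tau> by simp
    qed simp
  qed
  also have "\<dots> \<le> mass t" using st by (intro mass_ge) auto
  finally show ?thesis .
qed

text \<open>\<open>kato_blowup\<close> with \<open>t\<^sub>0 = T / 2\<close> and the constant of
  \<open>mass_step\<close>; the condition \<open>big\<close> is the one of
  \<open>kato_blowup\<close> with that constant inserted.\<close>

lemma blowup:
  assumes A: "A > 0" and \<beta>: "\<beta> > 0" "\<And>\<tau>. T / 2 \<le> \<tau> \<Longrightarrow> \<tau> < T \<Longrightarrow> pi * (\<tau> - l)\<^sup>2 \<le> \<beta>"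
    and base: "\<And>t. T / 2 \<le> t \<Longrightarrow> t < T \<Longrightarrow> ennreal A \<le> mass t"
    and big: "8 * (2 * \<beta> * (1 + T) / A) powr (p - 1) < (T / 2 * (1 - sqrt (2 powr (1 - p))))\<^sup>2"
  shows False
proof -
  let ?K = "1 / (4 * (2 * \<beta> * (1 + T)) powr (p - 1))"
  have "A powr (1 - p) = 1 / A powr (p - 1)" using powr_minus_divide[of A "p - 1"] by simp
  then have *: "2 * A powr (1 - p) / ?K < (T / 2 * (1 - sqrt (2 powr (1 - p))))\<^sup>2"
    using big A \<beta> T by (simp add: powr_divide)
  have "\<exists>t. T / 2 \<le> t \<and> t < 2 * (T / 2) \<and> mass t = \<infinity>"
  proof (rule kato_blowup[OF p A _ _ _ _ *])
    fix a s t :: real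
    assume "a > 0" "T / 2 \<le> s" "s \<le> t" "t < 2 * (T / 2)" "\<And>\<tau>. s \<le> \<tau> \<Longrightarrow> \<tau> \<le> t \<Longrightarrow> ennreal a \<le> mass \<tau>"
    then show "ennreal (?K * a powr p * (t - s)\<^sup>2) \<le> mass t"
      using T \<beta> by (intro mass_step) auto
  qed (use T \<beta> base in auto)
  then obtain t where "T / 2 \<le> t" "t < T" "mass t = \<infinity>" by auto
  with mass_finite[of t] T show False by simp
qed

end

section \<open>Logarithmic growth in the critical case\<close>

text \<open>\<open>m\<close> measures the linear part and will be proportional to the small
  parameter of the data. The bound \<open>1 \<le> l\<close> keeps \<open>norm x < t\<close> in the
  cone, away from the zero of the square root.\<close>

locale critical_supersolution = supersolution +
  fixes m :: real
  assumes p2: "p = 2" and l: "1 \<le> l" and m: "m > 0"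
    and super': "\<And>x t. 0 \<le> t \<Longrightarrow> t < T \<Longrightarrow> norm x \<le> t - l \<Longrightarrow>
      m / (2 * pi * sqrt (t\<^sup>2 - (norm x)\<^sup>2)) + duhamel_L p (\<lambda>z. \<bar>u z\<bar> powr p) x t \<le> u (x, t)"
begin

text \<open>The \<open>J\<close> of the overview, since \<open>p = 2\<close>. The interval is
  half-open to match the strict inequality in \<open>wave_kernel_ge\<close>.\<close>

definition charge :: "real \<Rightarrow> ennreal" where
  "charge s = (\<integral>\<^sup>+\<tau>. ennreal (1 / (1 + \<tau>) powr (p - 1)) * indicator {0..<s} \<tau> * source_mass \<tau> \<partial>lborel)"

text \<open>The linear part and the sources near the origin are bounded below by multiples of the
  same kernel, so their strengths add. The ball of radius \<open>\<tau> - l\<close> lies in the ball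
  of radius \<open>\<tau>\<close> required by \<open>nn_duhamel_ge_kernel\<close>.\<close>

lemma charge_le_u:
  assumes t: "0 \<le> t" "t < T" and x: "norm x \<le> t - l"
  shows "ennreal (1 / (2 * pi * sqrt (t\<^sup>2 - (norm x)\<^sup>2))) * (ennreal m + charge ((t - norm x) / 2)) \<le> ennreal (u (x, t))"
proof -
  let ?k = "1 / (2 * pi * sqrt (t\<^sup>2 - (norm x)\<^sup>2))"
  have lt: "norm x < t" using x l by linarith
  then have k: "?k \<ge> 0" by (simp add: power_mono)
  have "charge ((t - norm x) / 2) \<le> (\<integral>\<^sup>+\<tau>. ennreal (1 / (1 + \<tau>) powr (p - 1)) * indicator {0..<(t - norm x) / 2} \<tau> *
        (\<integral>\<^sup>+y. source (y, \<tau>) * indicator (cball 0 \<tau>) y \<partial>lborel) \<partial>lborel)"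
    unfolding charge_def source_mass_def using l
    by (intro nn_integral_mono mult_left_mono) (auto split: split_indicator)
  then have "ennreal ?k * charge ((t - norm x) / 2) \<le> nn_duhamel p source x t"
    by (intro order_trans[OF mult_left_mono nn_duhamel_ge_kernel[OF source_measurable lt]]) auto
  moreover have "ennreal ?k * ennreal m = ennreal (?k * m)"
    using k m by (intro ennreal_mult[symmetric]) auto
  ultimately have "ennreal ?k * ennreal m + ennreal ?k * charge ((t - norm x) / 2) \<le>
      ennreal (?k * m) + ennreal (duhamel_L p (\<lambda>z. \<bar>u z\<bar> powr p) x t)"
    unfolding ennreal_duhamel_source[OF t] by (metis add_left_mono)
  also have "\<dots> = ennreal (?k * m + duhamel_L p (\<lambda>z. \<bar>u z\<bar> powr p) x t)"
  proof (rule ennreal_plus[symmetric])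
    show "0 \<le> duhamel_L p (\<lambda>z. \<bar>u z\<bar> powr p) x t" by (rule duhamel_L_nonneg) simp
  qed (use k m in simp)
  also have "\<dots> \<le> ennreal (u (x, t))"
    using super'[OF t x] by (intro ennreal_leI) simp
  finally show ?thesis by (simp add: distrib_left)
qed

text \<open>On an annulus next to the light cone
  \<open>u \<ge> a / (2 * pi * sqrt (t\<^sup>2 - r\<^sup>2))\<close>. Squared and multiplied by
  \<open>2 * pi * r\<close>, this is \<open>a\<^sup>2 / (2 * pi) * r / ((t - r) * (t + r))\<close>,
  and integrating \<open>1 / (t - r)\<close> gives the logarithm.\<close>

lemma source_mass_ge_ln:
  assumes a: "a > 0" and s\<^sub>0: "l \<le> s\<^sub>0"
    and charge: "\<And>s. s\<^sub>0 \<le> s \<Longrightarrow> s < T \<Longrightarrow> ennreal a \<le> ennreal m + charge s"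
    and t: "4 * s\<^sub>0 \<le> t" "t < T"
  shows "ennreal (a\<^sup>2 / (6 * pi) * ln (t / (4 * s\<^sub>0))) \<le> source_mass t"
proof -
  have s0: "s\<^sub>0 > 0" "t > 0" using s\<^sub>0 l t by linarith+
  \<comment> \<open>The lower end gives \<open>r / (t + r) \<ge> 1 / 3\<close>, the upper end
    \<open>(t - r) / 2 \<ge> s\<^sub>0\<close>, so that the hypothesis on the charge
    applies.\<close>
  let ?I = "{t / 2..t - 2 * s\<^sub>0}"
  have "((\<lambda>r. - ln (t - r)) has_real_derivative 1 / (t - r)) (at r)" if "r \<in> ?I" for r
    using that s0 by (auto intro!: derivative_eq_intros simp: field_simps)
  then have "(\<integral>\<^sup>+r. ennreal (1 / (t - r)) * indicator ?I r \<partial>lborel) = ennreal (- ln (t - (t - 2 * s\<^sub>0)) - - ln (t - t / 2))"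
    using s0 t by (intro nn_integral_FTC_Icc) auto
  also have "- ln (t - (t - 2 * s\<^sub>0)) - - ln (t - t / 2) = ln (t / (4 * s\<^sub>0))"
    using s0 ln_realpow[of 2 2] by (simp add: ln_div ln_mult)
  finally have "ennreal (a\<^sup>2 / (6 * pi) * ln (t / (4 * s\<^sub>0))) =
      ennreal (a\<^sup>2 / (6 * pi)) * (\<integral>\<^sup>+r. ennreal (1 / (t - r)) * indicator ?I r \<partial>lborel)"
    using s0 t by (simp only:) (intro ennreal_mult, auto)
  also have "\<dots> = (\<integral>\<^sup>+r. ennreal (a\<^sup>2 / (6 * pi)) * (ennreal (1 / (t - r)) * indicator ?I r) \<partial>lborel)"
    by (simp add: nn_integral_cmult)
  also have "\<dots> \<le> (\<integral>\<^sup>+r. ennreal (2 * pi * r) * indicator {0..} r *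
      (ennreal ((a / (2 * pi * sqrt (t\<^sup>2 - r\<^sup>2)))\<^sup>2) * indicator ?I r) \<partial>lborel)"
  proof (rule nn_integral_mono)
    fix r
    show "ennreal (a\<^sup>2 / (6 * pi)) * (ennreal (1 / (t - r)) * indicator ?I r) \<le>
      ennreal (2 * pi * r) * indicator {0..} r * (ennreal ((a / (2 * pi * sqrt (t\<^sup>2 - r\<^sup>2)))\<^sup>2) * indicator ?I r)"
    proof (cases "r \<in> ?I")
      case True
      then have r: "0 < r" "t \<le> 2 * r" "r < t" using s0 by auto
      have sq: "t\<^sup>2 - r\<^sup>2 = (t - r) * (t + r)" by (simp add: power2_eq_square algebra_simps)
      have "2 * pi * r * (a / (2 * pi * sqrt (t\<^sup>2 - r\<^sup>2)))\<^sup>2 = a\<^sup>2 / (2 * pi) * (1 / (t - r)) * (r / (t + r))"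
      proof -
        have "0 \<le> (t - r) * (t + r)" using r by simp
        then have "(a / (2 * pi * sqrt (t\<^sup>2 - r\<^sup>2)))\<^sup>2 = a\<^sup>2 / (4 * pi\<^sup>2 * ((t - r) * (t + r)))"
          unfolding sq by (simp add: power_divide power_mult_distrib)
        then show ?thesis using r by (simp only:) (simp add: power2_eq_square)
      qed
      moreover have "1 / 3 \<le> r / (t + r)" using r by (simp add: field_simps)
      then have "a\<^sup>2 / (2 * pi) * (1 / (t - r)) * (1 / 3) \<le> a\<^sup>2 / (2 * pi) * (1 / (t - r)) * (r / (t + r))"
        using r by (intro mult_left_mono) auto
      ultimately have "a\<^sup>2 / (6 * pi) * (1 / (t - r)) \<le> 2 * pi * r * (a / (2 * pi * sqrt (t\<^sup>2 - r\<^sup>2)))\<^sup>2"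
        by simp
      then show ?thesis using True r by (simp add: ennreal_mult[symmetric] ennreal_leI)
    qed simp
  qed
  also have "\<dots> = (\<integral>\<^sup>+x. ennreal ((a / (2 * pi * sqrt (t\<^sup>2 - (norm x)\<^sup>2)))\<^sup>2) * indicator ?I (norm x) \<partial>(lborel :: (real^2) measure))"
    by (rule nn_integral_radial_2[symmetric]) measurable
  also have "\<dots> \<le> source_mass t"
    unfolding source_mass_def
  proof (rule nn_integral_mono)
    fix x :: "real^2"
    show "ennreal ((a / (2 * pi * sqrt (t\<^sup>2 - (norm x)\<^sup>2)))\<^sup>2) * indicator ?I (norm x) \<le>
       source (x, t) * indicator (cball 0 (t - l)) x"
    proof (cases "norm x \<in> ?I")
      case True
      then have x: "norm x \<le> t - 2 * s\<^sub>0" by simp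
      then have xl: "norm x \<le> t - l" "norm x < t" using s\<^sub>0 s0 l by linarith+
      have k: "1 / (2 * pi * sqrt (t\<^sup>2 - (norm x)\<^sup>2)) \<ge> 0" using xl by (simp add: power_mono)
      have half: "s\<^sub>0 \<le> (t - norm x) / 2" using x by simp
      have "t - norm x < T * 2" using t T norm_ge_zero[of x] by linarith
      then have half': "(t - norm x) / 2 < T" by simp
      have "ennreal (1 / (2 * pi * sqrt (t\<^sup>2 - (norm x)\<^sup>2))) * ennreal a \<le>
        ennreal (1 / (2 * pi * sqrt (t\<^sup>2 - (norm x)\<^sup>2))) * (ennreal m + charge ((t - norm x) / 2))"
        by (intro mult_left_mono charge half half') auto
      also have "\<dots> \<le> ennreal (u (x, t))" using s0 t xl by (intro charge_le_u) auto
      finally have "ennreal (a / (2 * pi * sqrt (t\<^sup>2 - (norm x)\<^sup>2))) \<le> ennreal (u (x, t))"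
        using k a by (simp add: ennreal_mult[symmetric])
      moreover have "a / (2 * pi * sqrt (t\<^sup>2 - (norm x)\<^sup>2)) > 0"
        using a xl by (simp add: power_strict_mono)
      ultimately have "0 < a / (2 * pi * sqrt (t\<^sup>2 - (norm x)\<^sup>2))" "a / (2 * pi * sqrt (t\<^sup>2 - (norm x)\<^sup>2)) \<le> u (x, t)"
        by (auto simp: ennreal_le_iff2)
      then have "(a / (2 * pi * sqrt (t\<^sup>2 - (norm x)\<^sup>2)))\<^sup>2 \<le> \<bar>u (x, t)\<bar> powr p"
        unfolding p2 by (subst powr_numeral) (auto intro!: power_mono)
      then show ?thesis using True s0 t xl by (simp add: source_eq ennreal_leI)
    qed simp
  qed
  finally show ?thesis .
qed

text \<open>Between \<open>4 * s\<^sub>0 * exp h\<close> and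
  \<open>4 * s\<^sub>0 * exp (2 * h)\<close> the logarithm of \<open>source_mass_ge_ln\<close> is at
  least \<open>h\<close>, and the interval has logarithmic length \<open>h\<close>. With
  \<open>1 + \<tau> \<le> 2 * \<tau>\<close> the charge gains
  \<open>a\<^sup>2 * h\<^sup>2 / (12 * pi)\<close>, which equals \<open>2 * a\<close> for
  \<open>h = sqrt (24 * pi / a)\<close>.\<close>

lemma charge_doubling:
  assumes a: "a > 0" and s\<^sub>0: "l \<le> s\<^sub>0"
    and charge: "\<And>s. s\<^sub>0 \<le> s \<Longrightarrow> s < T \<Longrightarrow> ennreal a \<le> ennreal m + charge s"
    and s: "5 * s\<^sub>0 * exp (2 * sqrt (24 * pi / a)) \<le> s" "s < T"
  shows "ennreal (2 * a) \<le> charge s"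
proof -
  define h where "h = sqrt (24 * pi / a)"
  have h: "h > 0" "h\<^sup>2 = 24 * pi / a" using a by (simp_all add: h_def)
  have s0: "s\<^sub>0 \<ge> 1" using s\<^sub>0 l by linarith
  let ?I = "{4 * s\<^sub>0 * exp h..4 * s\<^sub>0 * exp (2 * h)}"
  have e: "exp h > 1" "exp (2 * h) > 1" "exp h \<le> exp (2 * h)" using h by auto
  \<comment> \<open>The factor 5 in place of 4 makes the inequality strict, so that
    \<open>?I\<close> lies in the half-open interval \<open>{0..<s}\<close>.\<close>
  have lt: "4 * s\<^sub>0 * exp (2 * h) < s"
  proof -
    have "4 * s\<^sub>0 * exp (2 * h) < 5 * s\<^sub>0 * exp (2 * h)" using s0 by simp
    then show ?thesis using s(1) unfolding h_def by linarith
  qed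
  have ge1: "1 \<le> 4 * s\<^sub>0 * exp h"
    using mult_mono[of 1 "4 * s\<^sub>0" 1 "exp h"] s0 e by simp
  have ge4: "4 * s\<^sub>0 \<le> 4 * s\<^sub>0 * exp h" using s0 e by simp
  have "2 * a = a\<^sup>2 / (6 * pi) * h / 2 * h"
    using a h(2) by (simp add: power2_eq_square field_simps)
  moreover have "ln (4 * s\<^sub>0 * exp (2 * h) / (4 * s\<^sub>0 * exp h)) = h"
    using s0 by (simp add: exp_diff[symmetric])
  moreover have "ennreal (a\<^sup>2 / (6 * pi) * h / 2 * h) = ennreal (a\<^sup>2 / (6 * pi) * h / 2) * ennreal h"
    using h by (intro ennreal_mult) auto
  ultimately have "ennreal (2 * a) = ennreal (a\<^sup>2 / (6 * pi) * h / 2) * (\<integral>\<^sup>+\<tau>. ennreal (1 / \<tau>) * indicator ?I \<tau> \<partial>lborel)"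
    using s0 e by (subst nn_integral_inverse_Icc) auto
  also have "\<dots> = (\<integral>\<^sup>+\<tau>. ennreal (a\<^sup>2 / (6 * pi) * h / 2) * (ennreal (1 / \<tau>) * indicator ?I \<tau>) \<partial>lborel)"
    by (simp add: nn_integral_cmult)
  also have "\<dots> \<le> charge s"
    unfolding charge_def
  proof (rule nn_integral_mono)
    fix \<tau>
    show "ennreal (a\<^sup>2 / (6 * pi) * h / 2) * (ennreal (1 / \<tau>) * indicator ?I \<tau>) \<le>
      ennreal (1 / (1 + \<tau>) powr (p - 1)) * indicator {0..<s} \<tau> * source_mass \<tau>"
    proof (cases "\<tau> \<in> ?I")
      case True
      then have \<tau>: "1 \<le> \<tau>" "4 * s\<^sub>0 \<le> \<tau>" "\<tau> < s" "4 * s\<^sub>0 * exp h \<le> \<tau>" using ge1 ge4 lt by auto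
      have "h \<le> ln (\<tau> / (4 * s\<^sub>0))"
        using \<tau> s0 by (subst ln_ge_iff) (auto simp: field_simps)
      then have "a\<^sup>2 / (6 * pi) * h \<le> a\<^sup>2 / (6 * pi) * ln (\<tau> / (4 * s\<^sub>0))"
        by (intro mult_left_mono) auto
      then have N: "ennreal (a\<^sup>2 / (6 * pi) * h) \<le> source_mass \<tau>"
        using source_mass_ge_ln[OF a s\<^sub>0 charge \<tau>(2)] \<tau> s(2) by (meson ennreal_leI less_trans order_trans)
      have "a\<^sup>2 / (6 * pi) * h / 2 * (1 / \<tau>) \<le> 1 / (1 + \<tau>) * (a\<^sup>2 / (6 * pi) * h)"
      proof -
        have "1 / (2 * \<tau>) \<le> 1 / (1 + \<tau>)" using \<tau> by (simp add: field_simps)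
        then have "1 / (2 * \<tau>) * (a\<^sup>2 / (6 * pi) * h) \<le> 1 / (1 + \<tau>) * (a\<^sup>2 / (6 * pi) * h)"
          using h by (intro mult_right_mono) auto
        then show ?thesis by (simp add: mult_ac)
      qed
      then have "ennreal (a\<^sup>2 / (6 * pi) * h / 2) * ennreal (1 / \<tau>) \<le> ennreal (1 / (1 + \<tau>)) * ennreal (a\<^sup>2 / (6 * pi) * h)"
        using \<tau> h by (subst (1 2) ennreal_mult[symmetric]) (auto intro!: ennreal_leI)
      also have "\<dots> \<le> ennreal (1 / (1 + \<tau>)) * source_mass \<tau>" by (intro mult_left_mono N) simp
      finally show ?thesis using True \<tau> by (simp add: p2)
    qed simp
  qed
  finally show ?thesis .
qed

text \<open>Doubling from the level \<open>m * 2 ^ j\<close> multiplies the time by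
  \<open>5 * exp (2 * H * r ^ j)\<close> with \<open>H = sqrt (24 * pi / m)\<close>. The exponents
  are summable, so \<open>n\<close> doublings cost \<open>5 ^ n\<close> and one exponential of a
  multiple of \<open>H\<close>.\<close>

lemma charge_growth:
  assumes s: "l * 5 ^ n * exp (8 * sqrt (24 * pi / m)) \<le> s" "s < T"
  shows "ennreal (m * 2 ^ n) \<le> ennreal m + charge s"
proof -
  define H where "H = sqrt (24 * pi / m)"
  have H: "H > 0" using m by (simp add: H_def)
  \<comment> \<open>The waiting exponent is proportional to the level to the power -1/2, so doubling
    the level multiplies it by \<open>r\<close>.\<close>
  define r where "r = 1 / sqrt (2::real)"
  have r: "0 < r" "r \<le> 3 / 4"
  proof -
    have "4 / 3 \<le> sqrt (2::real)" by (rule real_le_rsqrt) (simp add: power2_eq_square)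
    then show "0 < r" "r \<le> 3 / 4" by (simp_all add: r_def field_simps)
  qed
  \<comment> \<open>\<open>8 * H * (1 - r ^ j)\<close> dominates the sum of
    \<open>2 * H * r ^ i\<close> over \<open>i < j\<close>, because
    \<open>8 * (1 - r) \<ge> 2\<close> for \<open>r \<le> 3 / 4\<close>.\<close>
  define \<sigma> where "\<sigma> j = l * 5 ^ j * exp (8 * H * (1 - r ^ j))" for j :: nat
  have \<sigma>_ge: "l \<le> \<sigma> j" for j
  proof -
    have "1 * 1 \<le> 5 ^ j * exp (8 * H * (1 - r ^ j))"
      using H r by (intro mult_mono) (auto simp: power_le_one)
    then have "l * 1 \<le> l * (5 ^ j * exp (8 * H * (1 - r ^ j)))" using l by (intro mult_left_mono) auto
    then show ?thesis by (simp add: \<sigma>_def mult.assoc)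
  qed
  have "ennreal (m * 2 ^ j) \<le> ennreal m + charge s" if "\<sigma> j \<le> s" "s < T" for j s
    using that
  proof (induction j arbitrary: s)
    case (Suc j)
    have "(sqrt 2) ^ j = sqrt (2 ^ j)" by (simp add: real_sqrt_power)
    then have sq: "sqrt (24 * pi / (m * 2 ^ j)) = H * r ^ j"
      by (simp add: H_def r_def power_divide real_sqrt_divide real_sqrt_mult)
    have "5 * \<sigma> j * exp (2 * sqrt (24 * pi / (m * 2 ^ j))) =
      l * 5 ^ Suc j * exp (8 * H * (1 - r ^ j) + 2 * (H * r ^ j))"
      by (simp add: \<sigma>_def sq exp_add)
    also have "\<dots> \<le> \<sigma> (Suc j)"
    proof -
      have "H * r ^ j * (8 * r) \<le> H * r ^ j * 6" using H r by (intro mult_left_mono) auto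
      then have "8 * H * (1 - r ^ j) + 2 * (H * r ^ j) \<le> 8 * H * (1 - r ^ Suc j)"
        by (simp add: algebra_simps)
      then show ?thesis unfolding \<sigma>_def using l by (intro mult_left_mono) auto
    qed
    finally have "ennreal (2 * (m * 2 ^ j)) \<le> charge s"
      using Suc.prems m by (intro charge_doubling[OF _ \<sigma>_ge Suc.IH]) auto
    then show ?case by (simp add: mult_ac add_increasing)
  qed simp
  moreover have "\<sigma> n \<le> s"
  proof -
    have "8 * H * (1 - r ^ n) \<le> 8 * H" using H r by (intro mult_left_le) auto
    then have "\<sigma> n \<le> l * 5 ^ n * exp (8 * H)" unfolding \<sigma>_def using l by (intro mult_left_mono) auto
    then show ?thesis using s(1) by (simp add: H_def)
  qed
  ultimately show ?thesis using s by blast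
qed

text \<open>Sources older than \<open>t / 2\<close> enter Duhamel's integral with a factor
  \<open>t - \<tau>\<close> of at least \<open>t / 2\<close>.\<close>

lemma mass_ge_charge:
  assumes t: "0 \<le> t" "t < T"
  shows "ennreal (t / 2) * charge (t / 2) \<le> mass t"
proof -
  have "ennreal (t / 2) * charge (t / 2) = (\<integral>\<^sup>+\<tau>. ennreal (t / 2) *
      (ennreal (1 / (1 + \<tau>) powr (p - 1)) * indicator {0..<t / 2} \<tau> * source_mass \<tau>) \<partial>lborel)"
    unfolding charge_def by (simp add: nn_integral_cmult)
  also have "\<dots> \<le> (\<integral>\<^sup>+\<tau>. ennreal ((t - \<tau>) / (1 + \<tau>) powr (p - 1)) * indicator {0..t} \<tau> * source_mass \<tau> \<partial>lborel)"
  proof (rule nn_integral_mono)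
    fix \<tau>
    show "ennreal (t / 2) * (ennreal (1 / (1 + \<tau>) powr (p - 1)) * indicator {0..<t / 2} \<tau> * source_mass \<tau>) \<le>
       ennreal ((t - \<tau>) / (1 + \<tau>) powr (p - 1)) * indicator {0..t} \<tau> * source_mass \<tau>"
    proof (cases "\<tau> \<in> {0..<t / 2}")
      case True
      then have "t / 2 * (1 / (1 + \<tau>) powr (p - 1)) \<le> (t - \<tau>) * (1 / (1 + \<tau>) powr (p - 1))"
        by (intro mult_right_mono) auto
      then have "ennreal (t / 2) * ennreal (1 / (1 + \<tau>) powr (p - 1)) \<le> ennreal ((t - \<tau>) / (1 + \<tau>) powr (p - 1))"
        using t by (subst ennreal_mult[symmetric]) (auto intro!: ennreal_leI)
      from mult_right_mono[OF this, of "source_mass \<tau>"] show ?thesis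
        using True by (simp add: mult.assoc)
    qed simp
  qed
  also have "\<dots> \<le> mass t" by (rule mass_ge[OF t])
  finally show ?thesis .
qed

text \<open>After \<open>n\<close> doublings the charge exceeds an absolute constant. The factor 4
  in the bound on \<open>T\<close> ensures this at time \<open>t / 2\<close> for every
  \<open>t \<ge> T / 2\<close>, and then the mass is large enough for \<open>blowup\<close>.\<close>

lemma critical_blowup:
  assumes n: "m * (2 ^ n - 1) \<ge> 2 ^ 15" and TT: "T \<ge> 4 * (l * 5 ^ n * exp (8 * sqrt (24 * pi / m)))"
  shows False
proof -
  have le: "l \<le> l * 5 ^ n * exp (8 * sqrt (24 * pi / m))"
  proof -
    have "1 * 1 \<le> 5 ^ n * exp (8 * sqrt (24 * pi / m))"
      using m by (intro mult_mono) auto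
    then have "l * 1 \<le> l * (5 ^ n * exp (8 * sqrt (24 * pi / m)))" using l by (intro mult_left_mono) auto
    then show ?thesis by (simp add: mult.assoc)
  qed
  then have Tl: "4 * l \<le> T" using TT by linarith
  then have T1: "1 \<le> T" using l by linarith
  \<comment> \<open>The exponent 15 turns the left side of the blow-up condition into at most
    \<open>pi * T\<^sup>2 / 2 ^ 8\<close>, which is below \<open>(T / 8)\<^sup>2\<close> since
    \<open>pi < 4\<close>.\<close>
  define A where "A = T / 4 * 2 ^ 15"
  have A: "A > 0" using T by (simp add: A_def)
  show False
  proof (rule blowup[OF A, of "pi * T\<^sup>2"])
    show "0 < pi * T\<^sup>2" using T by simp
    show "pi * (\<tau> - l)\<^sup>2 \<le> pi * T\<^sup>2" if "T / 2 \<le> \<tau>" "\<tau> < T" for \<tau>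
      using that Tl l by (intro mult_left_mono power_mono) auto
    show "ennreal A \<le> mass t" if t: "T / 2 \<le> t" "t < T" for t
    proof -
      have "ennreal (m * 2 ^ n) \<le> ennreal m + charge (t / 2)"
        using t TT T by (intro charge_growth) auto
      moreover have "ennreal (m * 2 ^ n) = ennreal m + ennreal (m * (2 ^ n - 1))"
        using m by (subst ennreal_plus[symmetric]) (auto simp: algebra_simps)
      ultimately have "ennreal (m * (2 ^ n - 1)) \<le> charge (t / 2)"
        by (simp add: ennreal_add_left_cancel_le)
      with n have c: "ennreal (2 ^ 15) \<le> charge (t / 2)" by (meson ennreal_leI order_trans)
      have "ennreal A = ennreal (T / 4) * ennreal (2 ^ 15)"
        unfolding A_def using T by (intro ennreal_mult) auto
      also have "\<dots> \<le> ennreal (t / 2) * charge (t / 2)"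
        using t by (intro mult_mono c ennreal_leI) auto
      also have "\<dots> \<le> mass t" using t T by (intro mass_ge_charge) auto
      finally show ?thesis .
    qed
    have "sqrt (1 / 2) \<le> (3 / 4 :: real)"
      by (rule real_le_lsqrt) (auto simp: power2_eq_square)
    then have le: "(T / 2 * (1 / 4))\<^sup>2 \<le> (T / 2 * (1 - sqrt (1 / 2)))\<^sup>2"
      using T by (intro power_mono mult_left_mono) auto
    have "8 * (2 * (pi * T\<^sup>2) * (1 + T) / A) < (T / 2 * (1 / 4))\<^sup>2"
    proof -
      have "2 * (pi * T\<^sup>2) * (1 + T) \<le> 2 * (pi * T\<^sup>2) * (2 * T)"
        using T1 by (intro mult_left_mono) auto
      then have "8 * (2 * (pi * T\<^sup>2) * (1 + T) / A) \<le> 8 * (2 * (pi * T\<^sup>2) * (2 * T) / A)"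
        using A T1 by (intro mult_left_mono divide_right_mono) auto
      also have "\<dots> = pi * T\<^sup>2 / 2 ^ 8" using T by (simp add: A_def)
      also have "\<dots> < 4 * T\<^sup>2 / 2 ^ 8" using T pi_less_4 by (simp add: divide_strict_right_mono)
      also have "\<dots> = (T / 2 * (1 / 4))\<^sup>2" by (simp add: power2_eq_square)
      finally show ?thesis .
    qed
    from less_le_trans[OF this le]
    have "8 * (2 * (pi * T\<^sup>2) * (1 + T) / A) < (T / 2 * (1 - sqrt (1 / 2)))\<^sup>2" .
    moreover have "(2::real) powr (1 - p) = 1 / 2" unfolding p2 by (simp add: powr_minus)
    ultimately show "8 * (2 * (pi * T\<^sup>2) * (1 + T) / A) powr (p - 1) < (T / 2 * (1 - sqrt (2 powr (1 - p))))\<^sup>2"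
      using A T by (simp add: p2)
  qed
qed

end

section \<open>The linear part\<close>

lemma C1_on_continuous: "C1_on S \<phi> \<Longrightarrow> continuous_on S \<phi>"
  unfolding C1_on_def by (auto simp: continuous_on_eq_continuous_within intro: has_derivative_continuous)

lemma C2_on_continuous: "C2_on S \<phi> \<Longrightarrow> continuous_on S \<phi>"
  unfolding C2_on_def by (auto simp: continuous_on_eq_continuous_within intro: has_derivative_continuous)

lemma supp_on_subsetD: "supp_on UNIV \<phi> \<subseteq> S \<Longrightarrow> x \<notin> S \<Longrightarrow> \<phi> x = 0"
  using closure_subset[of "support_on UNIV \<phi>"] by (auto simp: supp_on_def support_on_def)

lemma wave_R_nonneg: "(\<And>y. \<phi> y \<ge> 0) \<Longrightarrow> t \<ge> 0 \<Longrightarrow> wave_R \<phi> x t \<ge> 0"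
  unfolding wave_R_def by (intro mult_nonneg_nonneg disc_integral_nonneg) auto

lemma u_lin_zero: "u_lin (\<lambda>x. 0) g x t = wave_R g x t"
  by (simp add: u_lin_def wave_R_def disc_integral_def)

text \<open>\<open>wave_R\<close> is \<open>t\<close> times a disc average, so a nonnegative initial
  velocity produces mass that grows linearly in time.\<close>

lemma nn_integral_wave_R_ge:
  fixes \<phi> :: "real^2 \<Rightarrow> real"
  assumes cont: "continuous_on UNIV \<phi>" and nn: "\<And>y. \<phi> y \<ge> 0" and t: "t \<ge> 0"
  shows "ennreal t * (\<integral>\<^sup>+y. ennreal (\<phi> y) * indicator (cball 0 b) y \<partial>lborel)
    \<le> (\<integral>\<^sup>+x. ennreal (wave_R \<phi> x t) * indicator (cball 0 (t + b)) x \<partial>lborel)"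
proof -
  have [measurable]: "\<phi> \<in> borel_measurable borel" by (rule borel_measurable_continuous_onI[OF cont])
  have R: "ennreal (wave_R \<phi> x t) =
     ennreal (t / (2 * pi)) * (\<integral>\<^sup>+\<xi>. ennreal (disc_weight \<xi>) * ennreal (\<phi> (x + t *\<^sub>R \<xi>)) \<partial>lborel)" for x
  proof -
    have "compact ((\<lambda>\<xi>. \<phi> (x + t *\<^sub>R \<xi>)) ` cball 0 1)"
      by (intro compact_continuous_image continuous_on_compose2[OF cont] continuous_intros) auto
    then obtain C where C: "\<And>\<xi>. \<xi> \<in> cball 0 1 \<Longrightarrow> \<phi> (x + t *\<^sub>R \<xi>) \<le> C"
      by (metis (mono_tags, lifting) bounded_pos compact_imp_bounded imageI abs_le_D1 real_norm_def)
    have "ennreal (disc_integral (\<lambda>\<xi>. \<phi> (x + t *\<^sub>R \<xi>))) =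
        (\<integral>\<^sup>+\<xi>. ennreal (disc_weight \<xi>) * ennreal (\<phi> (x + t *\<^sub>R \<xi>)) \<partial>lborel)"
      using C nn by (intro ennreal_disc_integral[where C = C]) auto
    moreover have "ennreal (wave_R \<phi> x t) = ennreal (t / (2 * pi)) * ennreal (disc_integral (\<lambda>\<xi>. \<phi> (x + t *\<^sub>R \<xi>)))"
      unfolding wave_R_def using t nn by (intro ennreal_mult disc_integral_nonneg) auto
    ultimately show ?thesis by simp
  qed
  have "ennreal t = ennreal (t / (2 * pi)) * ennreal (2 * pi)"
    using t by (subst ennreal_mult[symmetric]) auto
  then have "ennreal t * (\<integral>\<^sup>+y. ennreal (\<phi> y) * indicator (cball 0 b) y \<partial>lborel) =
     ennreal (t / (2 * pi)) * (ennreal (2 * pi) * (\<integral>\<^sup>+y. ennreal (\<phi> y) * indicator (cball 0 b) y \<partial>lborel))"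
    by (simp only: mult.assoc)
  also have "\<dots> \<le> ennreal (t / (2 * pi)) * (\<integral>\<^sup>+x. (\<integral>\<^sup>+\<xi>. ennreal (disc_weight \<xi>) * ennreal (\<phi> (x + t *\<^sub>R \<xi>)) \<partial>lborel) *
      indicator (cball 0 (b + t)) x \<partial>lborel)"
    using t by (intro mult_left_mono nn_integral_spherical_mean_ge) auto
  also have "\<dots> = (\<integral>\<^sup>+x. ennreal (wave_R \<phi> x t) * indicator (cball 0 (t + b)) x \<partial>lborel)"
    unfolding R by (subst nn_integral_cmult[symmetric]) (simp_all add: mult.assoc add.commute)
  finally show ?thesis .
qed

text \<open>Differentiation under the integral is done over a box. The outer disc keeps the whole
  box inside the backward light cone as soon as \<open>norm x + 2 * k < t\<close>.\<close>

lemma cball_square_2: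
  fixes k :: real
  obtains a b :: "real^2" where "cball 0 k \<subseteq> cbox a b" "cbox a b \<subseteq> cball 0 (2 * k)"
proof
  let ?a = "(\<chi> i. - k) :: real^2" and ?b = "(\<chi> i. k) :: real^2"
  show "cball 0 k \<subseteq> cbox ?a ?b"
  proof
    fix y :: "real^2" assume "y \<in> cball 0 k"
    then have "norm y \<le> k" by simp
    then have "- k \<le> y $ i \<and> y $ i \<le> k" for i using component_le_norm_cart[of y i] by linarith
    then show "y \<in> cbox ?a ?b" by (simp add: mem_box_cart)
  qed
  show "cbox ?a ?b \<subseteq> cball 0 (2 * k)"
  proof
    fix y assume "y \<in> cbox ?a ?b"
    then have "- k \<le> y $ i \<and> y $ i \<le> k" for i by (simp add: mem_box_cart)
    then have "\<bar>y $ i\<bar> \<le> k" for i by (simp add: abs_le_iff minus_le_iff[of k])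
    from this[of 1] this[of 2] norm_le_l1_cart[of y] show "y \<in> cball 0 (2 * k)" by (simp add: sum_2)
  qed
qed

lemma lebesgue_integral_eq_integral_box:
  fixes \<phi> :: "real^2 \<Rightarrow> real"
  assumes "continuous_on (cbox a b) \<phi>" and "\<And>y. y \<notin> cbox a b \<Longrightarrow> \<phi> y = 0"
  shows "(LINT y|lborel. \<phi> y) = integral (cbox a b) \<phi>"
proof -
  have "set_integrable lborel (cbox a b) \<phi>"
    unfolding set_integrable_def by (intro borel_integrable_compact assms) simp
  then have "(LINT y:cbox a b|lborel. \<phi> y) = integral (cbox a b) \<phi>"
    by (rule set_borel_integral_eq_integral)
  moreover have "(LINT y:cbox a b|lborel. \<phi> y) = (LINT y|lborel. \<phi> y)"
    unfolding set_lebesgue_integral_def using assms(2)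
    by (intro Bochner_Integration.integral_cong) (auto simp: indicator_def)
  ultimately show ?thesis by simp
qed

text \<open>Far inside the light cone the kernel and its time derivative are compared with the
  kernel of a point source at the origin.\<close>

lemma linear_kernel_ge:
  fixes x y :: "real^2" and \<alpha> \<beta> :: real
  assumes k: "k \<ge> 1" and y: "norm y \<le> k" and l: "l \<ge> 6 * k" and x: "norm x \<le> t - l"
  shows "(\<alpha> - 6 * k / l * (\<bar>\<alpha>\<bar> + \<bar>\<beta>\<bar>)) / sqrt (t\<^sup>2 - (norm x)\<^sup>2)
    \<le> \<alpha> / sqrt (t\<^sup>2 - (norm (y - x))\<^sup>2) - t * \<beta> / sqrt (t\<^sup>2 - (norm (y - x))\<^sup>2) ^ 3"
proof -
  define D\<^sub>0 where "D\<^sub>0 = t\<^sup>2 - (norm x)\<^sup>2"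
  define D where "D = t\<^sup>2 - (norm (y - x))\<^sup>2"
  have lt: "l > 0" "t > 0" "k \<le> t" "norm x \<le> t" using k l x norm_ge_zero[of x] by linarith+
  have "D\<^sub>0 = (t - norm x) * (t + norm x)" by (simp add: D\<^sub>0_def power2_eq_square algebra_simps)
  moreover have "l * t \<le> (t - norm x) * (t + norm x)" using x lt by (intro mult_mono) auto
  ultimately have D0: "l * t \<le> D\<^sub>0" by simp
  then have D0_pos: "D\<^sub>0 > 0" using lt by (smt (verit) mult_pos_pos)
  have "D - D\<^sub>0 = 2 * (y \<bullet> x) - (norm y)\<^sup>2"
    by (simp add: D_def D\<^sub>0_def power2_norm_eq_inner inner_diff inner_commute)
  then have "\<bar>D - D\<^sub>0\<bar> \<le> 2 * \<bar>y \<bullet> x\<bar> + (norm y)\<^sup>2"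
    using zero_le_power2[of "norm y"] by linarith
  also have "\<dots> \<le> 2 * (k * t) + k * t"
  proof (intro add_mono mult_left_mono)
    show "\<bar>y \<bullet> x\<bar> \<le> k * t"
      using Cauchy_Schwarz_ineq2[of y x] mult_mono[of "norm y" k "norm x" t] y k lt by simp
    show "(norm y)\<^sup>2 \<le> k * t"
      unfolding power2_eq_square using y k lt by (intro mult_mono) auto
  qed simp
  also have "\<dots> = 3 * k / l * (l * t)" using lt by simp
  also have "\<dots> \<le> 3 * k / l * D\<^sub>0" using D0 k lt by (intro mult_left_mono) auto
  finally have diff: "\<bar>D - D\<^sub>0\<bar> \<le> 3 * k / l * D\<^sub>0" .
  have "3 * k / l * D\<^sub>0 \<le> 1 / 2 * D\<^sub>0"
    using l lt D0_pos by (intro mult_right_mono) (auto simp: field_simps)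
  with diff have half: "D\<^sub>0 / 2 \<le> D" by linarith
  then have D_pos: "D > 0" using D0_pos by linarith
  \<comment> \<open>The ratio of the kernel at \<open>y - x\<close> to the kernel of a source at the
    origin.\<close>
  define \<rho> where "\<rho> = sqrt (D\<^sub>0 / D)"
  have \<rho>2: "\<rho>\<^sup>2 = D\<^sub>0 / D" "\<rho> > 0" using D_pos D0_pos by (simp_all add: \<rho>_def)
  have \<rho>sq: "sqrt D * \<rho> = sqrt D\<^sub>0" using D_pos by (simp add: \<rho>_def real_sqrt_mult[symmetric])
  have "D\<^sub>0 / D \<le> 2" using half D_pos by (simp add: field_simps)
  then have \<rho>_le: "\<rho> \<le> 2" unfolding \<rho>_def by (intro real_le_lsqrt) auto
  \<comment> \<open>Since \<open>\<rho> + 1 \<ge> 1\<close>, the distance of \<open>\<rho>\<close>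
    from 1 is at most that of its square, and the latter is a rational expression in
    \<open>D\<close> and \<open>D\<^sub>0\<close>.\<close>
  have "\<bar>\<rho> - 1\<bar> * 1 \<le> \<bar>\<rho> - 1\<bar> * \<bar>\<rho> + 1\<bar>" using \<rho>2 by (intro mult_left_mono) auto
  also have "\<dots> = \<bar>D\<^sub>0 / D - 1\<bar>"
    unfolding \<rho>2(1)[symmetric] abs_mult[symmetric] by (simp add: power2_eq_square algebra_simps)
  also have "\<dots> = \<bar>D - D\<^sub>0\<bar> / D" using D_pos by (simp add: field_simps abs_if)
  also have "\<dots> \<le> 3 * k / l * D\<^sub>0 / D" using diff D_pos by (intro divide_right_mono) auto
  also have "\<dots> = 3 * k / l * (D\<^sub>0 / D)" by simp
  also have "\<dots> \<le> 3 * k / l * 2" using \<open>D\<^sub>0 / D \<le> 2\<close> k lt by (intro mult_left_mono) auto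
  finally have \<rho>1: "\<bar>\<rho> - 1\<bar> \<le> 6 * k / l" by simp
  have "\<rho> * \<alpha> \<ge> \<alpha> - 6 * k / l * \<bar>\<alpha>\<bar>"
  proof -
    have "\<bar>(\<rho> - 1) * \<alpha>\<bar> \<le> 6 * k / l * \<bar>\<alpha>\<bar>"
      unfolding abs_mult using \<rho>1 by (intro mult_right_mono) auto
    then show ?thesis by (simp add: algebra_simps abs_le_iff)
  qed
  moreover have "\<rho> * (t / D) * \<beta> \<le> 6 * k / l * \<bar>\<beta>\<bar>"
  proof -
    \<comment> \<open>Differentiating the kernel in time multiplies it by \<open>- t / D\<close>;
      far inside the cone this factor is small, so the contribution of the initial displacement is
      an error term.\<close>
    have "t / D \<le> 2 / l"
    proof -
      have "l * t \<le> 2 * D" using D0 half by linarith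
      then show ?thesis using D_pos lt by (simp add: field_simps)
    qed
    then have "\<rho> * (t / D) \<le> 2 * (2 / l)" using \<rho>2 \<rho>_le lt D_pos by (intro mult_mono) auto
    also have "\<dots> \<le> 6 * k / l" using k lt by (simp add: field_simps)
    finally have le: "\<rho> * (t / D) * \<bar>\<beta>\<bar> \<le> 6 * k / l * \<bar>\<beta>\<bar>" by (intro mult_right_mono) auto
    have "\<rho> * (t / D) * \<beta> \<le> \<rho> * (t / D) * \<bar>\<beta>\<bar>"
      using \<rho>2 lt D_pos by (intro mult_left_mono) auto
    from order_trans[OF this le] show ?thesis .
  qed
  ultimately have "(\<alpha> - 6 * k / l * (\<bar>\<alpha>\<bar> + \<bar>\<beta>\<bar>)) / sqrt D\<^sub>0 \<le> (\<rho> * \<alpha> - \<rho> * (t / D) * \<beta>) / sqrt D\<^sub>0"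
    using D0_pos by (intro divide_right_mono) (auto simp: distrib_left)
  also have "\<dots> = \<alpha> / sqrt D - t * \<beta> / sqrt D ^ 3"
  proof -
    have "sqrt D ^ 3 = sqrt D * D" using D_pos by (simp add: power3_eq_cube)
    then show ?thesis unfolding \<rho>sq[symmetric] using \<rho>2(2) D_pos by (simp add: field_simps)
  qed
  finally show ?thesis by (simp add: D_def D\<^sub>0_def)
qed

text \<open>The margin \<open>2 * k\<close> places the box strictly inside the backward cone, where
  the indicator in the kernel is 1 and the square root stays positive.\<close>

lemma wave_R_eq_integral:
  fixes \<phi> :: "real^2 \<Rightarrow> real"
  assumes cont: "continuous_on UNIV \<phi>" and supp: "\<And>y. norm y > k \<Longrightarrow> \<phi> y = 0"
    and k: "k \<ge> 0" and box: "cball 0 k \<subseteq> cbox a b" "cbox a b \<subseteq> cball 0 (2 * k)"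
    and t: "norm x + 2 * k < t"
  shows "wave_R \<phi> x t = 1 / (2 * pi) * integral (cbox a b) (\<lambda>y. \<phi> y / sqrt (t\<^sup>2 - (norm (y - x))\<^sup>2))"
    and "continuous_on (cbox a b) (\<lambda>y. \<phi> y / sqrt (t\<^sup>2 - (norm (y - x))\<^sup>2))"
proof -
  have [measurable]: "\<phi> \<in> borel_measurable borel" by (rule borel_measurable_continuous_onI[OF cont])
  have t0: "t > 0" using t k norm_ge_zero[of x] by linarith
  have lt: "norm (y - x) < t" if "norm y \<le> 2 * k" for y
    using that t norm_triangle_ineq4[of y x] by linarith
  have pos: "t\<^sup>2 - (norm (y - x))\<^sup>2 > 0" if "y \<in> cbox a b" for y
    using lt[of y] that box by (auto simp: power_strict_mono subset_iff)
  show cont': "continuous_on (cbox a b) (\<lambda>y. \<phi> y / sqrt (t\<^sup>2 - (norm (y - x))\<^sup>2))"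
    using pos by (intro continuous_intros continuous_on_subset[OF cont]) fastforce+
  have "wave_R \<phi> x t = 1 / (2 * pi) * (LINT y|lborel. wave_kernel t (y - x) * \<phi> y)"
    unfolding wave_R_def using disc_integral_eq_kernel[of \<phi> t x] t0 by simp
  also have "(LINT y|lborel. wave_kernel t (y - x) * \<phi> y) = (LINT y|lborel. \<phi> y / sqrt (t\<^sup>2 - (norm (y - x))\<^sup>2))"
  proof (intro Bochner_Integration.integral_cong refl)
    fix y
    show "wave_kernel t (y - x) * \<phi> y = \<phi> y / sqrt (t\<^sup>2 - (norm (y - x))\<^sup>2)"
      using supp[of y] lt[of y] k by (cases "norm y \<le> k") (auto simp: wave_kernel_def indicator_def)
  qed
  also have "\<dots> = integral (cbox a b) (\<lambda>y. \<phi> y / sqrt (t\<^sup>2 - (norm (y - x))\<^sup>2))"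
  proof (rule lebesgue_integral_eq_integral_box[OF cont'])
    fix y assume "y \<notin> cbox a b"
    then have "norm y > k" using box(1) by (metis mem_cball_0 not_le subsetD)
    then show "\<phi> y / sqrt (t\<^sup>2 - (norm (y - x))\<^sup>2) = 0" by (simp add: supp)
  qed
  finally show "wave_R \<phi> x t = 1 / (2 * pi) * integral (cbox a b) (\<lambda>y. \<phi> y / sqrt (t\<^sup>2 - (norm (y - x))\<^sup>2))" .
qed

text \<open>In kernel form time occurs only in the kernel, which is smooth over a fixed box for all
  times in the open half-line \<open>U\<close>; the Leibniz rule then puts no derivative on
  \<open>\<phi>\<close>.\<close>

lemma deriv_wave_R:
  fixes \<phi> :: "real^2 \<Rightarrow> real"
  assumes cont: "continuous_on UNIV \<phi>" and supp: "\<And>y. norm y > k \<Longrightarrow> \<phi> y = 0"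
    and k: "k \<ge> 0" and box: "cball 0 k \<subseteq> cbox a b" "cbox a b \<subseteq> cball 0 (2 * k)"
    and t: "norm x + 2 * k < t"
  shows "deriv (wave_R \<phi> x) t =
      - (1 / (2 * pi) * integral (cbox a b) (\<lambda>y. t * \<phi> y / sqrt (t\<^sup>2 - (norm (y - x))\<^sup>2) ^ 3))"
    and "continuous_on (cbox a b) (\<lambda>y. t * \<phi> y / sqrt (t\<^sup>2 - (norm (y - x))\<^sup>2) ^ 3)"
proof -
  define U where "U = {norm x + 2 * k<..}"
  have pos: "s\<^sup>2 - (norm (y - x))\<^sup>2 > 0" if "s \<in> U" "y \<in> cbox a b" for s y
  proof -
    have "norm y \<le> 2 * k" using that box by auto
    then have "norm (y - x) < s"
      using that(1) norm_triangle_ineq4[of y x] by (simp add: U_def)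
    then show ?thesis by (simp add: power_strict_mono)
  qed
  have tU: "t \<in> U" using t by (simp add: U_def)
  show cont1: "continuous_on (cbox a b) (\<lambda>y. t * \<phi> y / sqrt (t\<^sup>2 - (norm (y - x))\<^sup>2) ^ 3)"
    using pos[OF tU] by (intro continuous_intros continuous_on_subset[OF cont]) fastforce+
  have "((\<lambda>s. integral (cbox a b) (\<lambda>y. \<phi> y / sqrt (s\<^sup>2 - (norm (y - x))\<^sup>2))) has_field_derivative
      integral (cbox a b) (\<lambda>y. - (t * \<phi> y / sqrt (t\<^sup>2 - (norm (y - x))\<^sup>2) ^ 3))) (at t within U)"
  proof (rule leibniz_rule_field_derivative)
    fix s y assume s: "s \<in> U" and y: "y \<in> cbox a b"
    let ?d = "s\<^sup>2 - (norm (y - x))\<^sup>2"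
    have p: "?d > 0" by (rule pos[OF s y])
    have "((\<lambda>s. \<phi> y / sqrt (s\<^sup>2 - (norm (y - x))\<^sup>2)) has_field_derivative
       (0 * sqrt ?d - \<phi> y * (2 * s * (inverse (sqrt ?d) / 2))) / (sqrt ?d * sqrt ?d)) (at s within U)"
      using p by (auto intro!: derivative_eq_intros)
    moreover have "(0 * sqrt ?d - \<phi> y * (2 * s * (inverse (sqrt ?d) / 2))) / (sqrt ?d * sqrt ?d) = - (s * \<phi> y / sqrt ?d ^ 3)"
      using p by (simp add: power3_eq_cube field_simps)
    ultimately show "((\<lambda>s. \<phi> y / sqrt (s\<^sup>2 - (norm (y - x))\<^sup>2)) has_field_derivative
       - (s * \<phi> y / sqrt ?d ^ 3)) (at s within U)" by simp
  next
    fix s assume "s \<in> U"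
    then show "(\<lambda>y. \<phi> y / sqrt (s\<^sup>2 - (norm (y - x))\<^sup>2)) integrable_on cbox a b"
      by (intro integrable_continuous wave_R_eq_integral(2)[OF cont supp k box]) (auto simp: U_def)
  next
    show "continuous_on (U \<times> cbox a b) (\<lambda>(s, y). - (s * \<phi> y / sqrt (s\<^sup>2 - (norm (y - x))\<^sup>2) ^ 3))"
      unfolding split_beta using pos
      by (intro continuous_intros continuous_on_compose2[OF cont]) fastforce+
  qed (use tU in \<open>auto simp: U_def\<close>)
  then have "((\<lambda>s. 1 / (2 * pi) * integral (cbox a b) (\<lambda>y. \<phi> y / sqrt (s\<^sup>2 - (norm (y - x))\<^sup>2))) has_field_derivative
      1 / (2 * pi) * integral (cbox a b) (\<lambda>y. - (t * \<phi> y / sqrt (t\<^sup>2 - (norm (y - x))\<^sup>2) ^ 3))) (at t within U)"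
    by (rule DERIV_cmult)
  then have "((\<lambda>s. 1 / (2 * pi) * integral (cbox a b) (\<lambda>y. \<phi> y / sqrt (s\<^sup>2 - (norm (y - x))\<^sup>2))) has_field_derivative
      1 / (2 * pi) * integral (cbox a b) (\<lambda>y. - (t * \<phi> y / sqrt (t\<^sup>2 - (norm (y - x))\<^sup>2) ^ 3))) (at t)"
    using at_within_open[OF tU] by (simp add: U_def)
  then have "(wave_R \<phi> x has_field_derivative
      1 / (2 * pi) * integral (cbox a b) (\<lambda>y. - (t * \<phi> y / sqrt (t\<^sup>2 - (norm (y - x))\<^sup>2) ^ 3))) (at t)"
    by (rule has_field_derivative_transform_within_open[where S = U])
      (auto simp: U_def t wave_R_eq_integral(1)[OF cont supp k box])
  then show "deriv (wave_R \<phi> x) t =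
      - (1 / (2 * pi) * integral (cbox a b) (\<lambda>y. t * \<phi> y / sqrt (t\<^sup>2 - (norm (y - x))\<^sup>2) ^ 3))"
    by (subst DERIV_imp_deriv) simp_all
qed

lemma u_lin_lower_bound:
  fixes f g :: "real^2 \<Rightarrow> real"
  assumes cont: "continuous_on UNIV f" "continuous_on UNIV g"
    and supp: "\<And>y. norm y > k \<Longrightarrow> f y = 0" "\<And>y. norm y > k \<Longrightarrow> g y = 0"
    and k: "k \<ge> 1" and M: "(LINT x|lborel. f x + g x) > 0"
  obtains l m where "l \<ge> 1" "m > 0" "\<And>x t. norm x \<le> t - l \<Longrightarrow> m / (2 * pi * sqrt (t\<^sup>2 - (norm x)\<^sup>2)) \<le> u_lin f g x t"
proof -
  obtain a b :: "real^2" where box: "cball 0 k \<subseteq> cbox a b" "cbox a b \<subseteq> cball 0 (2 * k)"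
    by (rule cball_square_2)
  let ?h = "\<lambda>y. f y + g y"
  define M where "M = (LINT x|lborel. ?h x)"
  have contB: "continuous_on (cbox a b) f" "continuous_on (cbox a b) g"
    using cont continuous_on_subset by blast+
  have M_eq: "M = integral (cbox a b) ?h"
    unfolding M_def
  proof (rule lebesgue_integral_eq_integral_box)
    fix y assume "y \<notin> cbox a b"
    then have "norm y > k" using box(1) by (metis mem_cball_0 not_le subsetD)
    then show "?h y = 0" by (simp add: supp)
  qed (intro continuous_intros contB)
  define Q where "Q = integral (cbox a b) (\<lambda>y. \<bar>?h y\<bar> + \<bar>f y\<bar>)"
  have Q: "Q \<ge> 0" unfolding Q_def
    by (intro Henstock_Kurzweil_Integration.integral_nonneg integrable_continuous continuous_intros contB) auto
  \<comment> \<open>\<open>6 * k\<close> is what \<open>linear_kernel_ge\<close> demands; the other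
    entry makes the integrated error \<open>6 * k / l * Q\<close> at most
    \<open>M / 2\<close>.\<close>
  define l where "l = max (6 * k) (12 * k * Q / M)"
  have l: "l \<ge> 6 * k" "12 * k * Q / M \<le> l" by (simp_all add: l_def)
  have l0: "l > 0" using l k by linarith
  show ?thesis
  proof (rule that[of l "M / 2"])
    show "l \<ge> 1" using l k by linarith
    show "M / 2 > 0" using M by (simp add: M_def)
    fix x :: "real^2" and t assume x: "norm x \<le> t - l"
    let ?D = "\<lambda>y. t\<^sup>2 - (norm (y - x))\<^sup>2"
    let ?s = "sqrt (t\<^sup>2 - (norm x)\<^sup>2)"
    have t: "norm x + 2 * k < t" using x l k by linarith
    have s: "?s \<ge> 0" using t k by (simp add: power_mono)
    have k0: "k \<ge> 0" using k by simp
    note R = wave_R_eq_integral[OF _ _ k0 box t, of ?h]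
    note R' = deriv_wave_R[OF cont(1) supp(1) k0 box t]
    have conth: "continuous_on UNIV ?h" by (intro continuous_intros cont)
    have c1: "continuous_on (cbox a b) (\<lambda>y. ?h y / sqrt (?D y))"
      by (rule R(2)[OF conth]) (simp add: supp)
    have "(M - 6 * k / l * Q) / ?s = integral (cbox a b) (\<lambda>y. (?h y - 6 * k / l * (\<bar>?h y\<bar> + \<bar>f y\<bar>)) / ?s)"
    proof -
      have i: "?h integrable_on cbox a b" "(\<lambda>y. \<bar>?h y\<bar> + \<bar>f y\<bar>) integrable_on cbox a b"
        by (intro integrable_continuous continuous_intros contB)+
      show ?thesis
        unfolding M_eq Q_def
        by (simp only: integral_divide integral_mult_right
            Henstock_Kurzweil_Integration.integral_diff[OF i(1) integrable_on_mult_right[OF i(2)]])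
    qed
    also have "\<dots> \<le> integral (cbox a b) (\<lambda>y. ?h y / sqrt (?D y) - t * f y / sqrt (?D y) ^ 3)"
    proof (rule integral_le)
      show "(\<lambda>y. (?h y - 6 * k / l * (\<bar>?h y\<bar> + \<bar>f y\<bar>)) / ?s) integrable_on cbox a b"
        unfolding divide_inverse by (intro integrable_continuous continuous_intros contB)
      show "(\<lambda>y. ?h y / sqrt (?D y) - t * f y / sqrt (?D y) ^ 3) integrable_on cbox a b"
        by (intro integrable_continuous continuous_on_diff c1 R'(2))
      fix y
      show "(?h y - 6 * k / l * (\<bar>?h y\<bar> + \<bar>f y\<bar>)) / ?s \<le> ?h y / sqrt (?D y) - t * f y / sqrt (?D y) ^ 3"
        using linear_kernel_ge[OF k _ l(1) x, of y "?h y" "f y"] supp[of y] by (cases "norm y \<le> k") auto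
    qed
    finally have le: "(M - 6 * k / l * Q) / ?s \<le> integral (cbox a b) (\<lambda>y. ?h y / sqrt (?D y) - t * f y / sqrt (?D y) ^ 3)" .
    have "M / 2 / (2 * pi * ?s) = 1 / (2 * pi) * (M / 2 / ?s)" by simp
    also have "\<dots> \<le> 1 / (2 * pi) * ((M - 6 * k / l * Q) / ?s)"
    proof -
      have "M > 0" using M by (simp add: M_def)
      then have "12 * k * Q \<le> l * M" using l(2) by (simp add: field_simps)
      then have "M / 2 \<le> M - 6 * k / l * Q" using l0 by (simp add: field_simps)
      then show ?thesis using s by (intro mult_left_mono divide_right_mono) auto
    qed
    also have "\<dots> \<le> 1 / (2 * pi) * integral (cbox a b) (\<lambda>y. ?h y / sqrt (?D y) - t * f y / sqrt (?D y) ^ 3)"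
      by (intro mult_left_mono le) simp
    also have "\<dots> = u_lin f g x t"
    proof -
      have "wave_R ?h x t = 1 / (2 * pi) * integral (cbox a b) (\<lambda>y. ?h y / sqrt (?D y))"
        by (rule R(1)[OF conth]) (simp add: supp)
      moreover have "integral (cbox a b) (\<lambda>y. ?h y / sqrt (?D y) - t * f y / sqrt (?D y) ^ 3) =
        integral (cbox a b) (\<lambda>y. ?h y / sqrt (?D y)) - integral (cbox a b) (\<lambda>y. t * f y / sqrt (?D y) ^ 3)"
        by (intro Henstock_Kurzweil_Integration.integral_diff integrable_continuous c1 R'(2))
      ultimately show ?thesis
        unfolding u_lin_def by (simp only: R'(1) right_diff_distrib)
    qed
    finally show "M / 2 / (2 * pi * ?s) \<le> u_lin f g x t" .
  qed
qed

section \<open>Nonexistence\<close>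

lemma two_power_between:
  assumes "X \<ge> (1::real)"
  obtains n :: nat where "X \<le> 2 ^ n" "2 ^ n \<le> 2 * X"
proof -
  define n where "n = nat \<lceil>log 2 X\<rceil>"
  have "0 \<le> log 2 X" using assms by simp
  then have n: "log 2 X \<le> real n" "real n \<le> log 2 X + 1"
    unfolding n_def by linarith+
  have "X = 2 powr log 2 X" using assms by simp
  also have "\<dots> \<le> 2 powr real n" using n by (intro powr_mono) auto
  finally have "X \<le> 2 ^ n" by (simp add: powr_realpow)
  moreover have "2 powr real n \<le> 2 powr (log 2 X + 1)" using n by (intro powr_mono) auto
  then have "2 ^ n \<le> 2 * X" using assms by (simp add: powr_realpow powr_add)
  ultimately show ?thesis by (rule that)
qed

text \<open>With \<open>A\<close> of order \<open>\<epsilon> * T\<close> and ball areas of order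
  \<open>T\<^sup>2\<close>, the condition of \<open>blowup\<close> compares
  \<open>(T\<^sup>2 / \<epsilon>) powr (p - 1)\<close> with \<open>T\<^sup>2\<close>. Solving for
  \<open>T\<close> gives the exponent of the lifespan bound.\<close>

lemma subcritical_nonexistence:
  fixes p k :: real and g :: "real^2 \<Rightarrow> real"
  assumes p_range: "1 < p" "p < 2" and k: "k \<ge> 1" and cont_g: "continuous_on UNIV g"
    and supp: "\<And>y. norm y > k \<Longrightarrow> g y = 0" and nn: "\<And>y. g y \<ge> 0" and nz: "g z \<noteq> 0"
  shows "\<exists>c>0. \<forall>\<epsilon> T u. 0 < \<epsilon> \<and> \<epsilon> \<le> 1 \<and> T \<ge> c * \<epsilon> powr (- (p - 1) / (4 - 2 * p)) \<and>
    continuous_on (space_time T) u \<longrightarrow> \<not> solves_integral_eq p \<epsilon> (\<lambda>x. 0) g T u"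
proof -
  have [measurable]: "g \<in> borel_measurable borel" by (rule borel_measurable_continuous_onI[OF cont_g])
  define I where "I = (\<integral>\<^sup>+y. ennreal (g y) * indicator (cball 0 k) y \<partial>lborel)"
  \<comment> \<open>A positive real lower bound for the total mass is taken from a small disc on
    which \<open>g\<close> exceeds half of \<open>g z\<close>; that disc lies in the
    support.\<close>
  obtain G where G: "G > 0" "ennreal G \<le> I"
  proof -
    have gz: "g z > 0" using nz nn[of z] by simp
    have "open {y. g z / 2 < g y}"
      by (rule open_Collect_less[OF continuous_on_const cont_g])
    moreover have "z \<in> {y. g z / 2 < g y}" using gz by simp
    ultimately obtain r where r: "r > 0" "cball z r \<subseteq> {y. g z / 2 < g y}"
      by (meson open_contains_cball)
    have "ennreal (g z / 2 * (pi * r\<^sup>2)) = ennreal (g z / 2) * emeasure lborel (cball z r)"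
      using r gz by (subst emeasure_cball_2) (simp, intro ennreal_mult, auto)
    also have "\<dots> = (\<integral>\<^sup>+y. ennreal (g z / 2) * indicator (cball z r) y \<partial>lborel)"
      by (simp add: nn_integral_cmult)
    also have "\<dots> \<le> I"
      unfolding I_def
    proof (rule nn_integral_mono)
      fix y
      have "norm y \<le> k" if "y \<in> cball z r"
        using that r(2) supp[of y] gz by (force simp: not_le[symmetric])
      then show "ennreal (g z / 2) * indicator (cball z r) y \<le> ennreal (g y) * indicator (cball 0 k) y"
        using r(2) by (auto split: split_indicator intro!: ennreal_leI)
    qed
    finally show ?thesis using that[of "g z / 2 * (pi * r\<^sup>2)"] gz r by simp
  qed
  define q where "q = sqrt (2 powr (1 - p))"
  have q: "q < 1"
  proof -
    have "(2::real) powr (1 - p) < 2 powr 0" using p_range by (intro powr_less_mono) auto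
    then show "q < 1" by (simp add: q_def)
  qed
  define C where "C = 32 / (1 - q)\<^sup>2 * (32 * pi / G) powr (p - 1)"
  have C: "C > 0" using q G by (simp add: C_def)
  \<comment> \<open>The entry \<open>k\<close> forces \<open>T \<ge> k \<ge> 1\<close> when
    \<open>\<epsilon> \<le> 1\<close>, so that \<open>1 + T \<le> 2 * T\<close> and the ball radii
    are at most \<open>2 * T\<close>. The other entry gives
    \<open>c powr (4 - 2 * p) \<ge> 2 * C\<close>, where the factor 2 makes the blow-up condition
    strict.\<close>
  define c where "c = max k ((2 * C) powr (1 / (4 - 2 * p)))"
  have c: "c \<ge> k" "c > 0" using k by (auto simp: c_def)
  have cC: "2 * C \<le> c powr (4 - 2 * p)"
  proof -
    have "2 * C = ((2 * C) powr (1 / (4 - 2 * p))) powr (4 - 2 * p)"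
      using p_range C by (simp add: powr_powr)
    also have "\<dots> \<le> c powr (4 - 2 * p)" using p_range by (intro powr_mono2) (auto simp: c_def)
    finally show ?thesis .
  qed
  show ?thesis
  proof (intro exI[of _ c] conjI allI impI notI c(2))
    fix \<epsilon> T :: real and u :: "(real^2) \<times> real \<Rightarrow> real"
    assume asm: "0 < \<epsilon> \<and> \<epsilon> \<le> 1 \<and> T \<ge> c * \<epsilon> powr (- (p - 1) / (4 - 2 * p)) \<and> continuous_on (space_time T) u"
      and sol: "solves_integral_eq p \<epsilon> (\<lambda>x. 0) g T u"
    have e: "0 < \<epsilon>" "\<epsilon> \<le> 1" using asm by auto
    have "1 \<le> \<epsilon> powr (- (p - 1) / (4 - 2 * p))"
    proof -
      have "1 powr (- (p - 1) / (4 - 2 * p)) \<le> \<epsilon> powr (- (p - 1) / (4 - 2 * p))"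
        using e p_range by (intro powr_mono2') (auto simp: divide_le_0_iff)
      then show ?thesis by simp
    qed
    then have "c * 1 \<le> c * \<epsilon> powr (- (p - 1) / (4 - 2 * p))" using c by (intro mult_left_mono) auto
    then have Tc: "T \<ge> c" using asm by linarith
    then have T_ge: "T \<ge> k" "T \<ge> 1" "T > 0" using c k by linarith+
    have sol': "u (x, t) = \<epsilon> * wave_R g x t + duhamel_L p (\<lambda>z. \<bar>u z\<bar> powr p) x t" if "0 \<le> t" "t < T" for x t
      using sol that by (auto simp: solves_integral_eq_def space_time_def u_lin_zero)
    have duh: "duhamel_L p (\<lambda>z. \<bar>u z\<bar> powr p) x t \<ge> 0" for x t by (rule duhamel_L_nonneg) simp
    interpret supersolution p T "- k" u
      using p_range T_ge asm e by unfold_locales (auto simp: sol' intro!: mult_nonneg_nonneg wave_R_nonneg nn)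
    define A where "A = \<epsilon> * (T / 2 * G)"
    have A: "A > 0" using e T_ge G by (simp add: A_def)
    show False
    proof (rule blowup[OF A, of "4 * pi * T\<^sup>2"])
      show "0 < 4 * pi * T\<^sup>2" using T_ge by simp
      show "pi * (\<tau> - - k)\<^sup>2 \<le> 4 * pi * T\<^sup>2" if "T / 2 \<le> \<tau>" "\<tau> < T" for \<tau>
      proof -
        have "(\<tau> - - k)\<^sup>2 \<le> (2 * T)\<^sup>2" using that T_ge k by (intro power_mono) auto
        then show ?thesis by (simp add: power_mult_distrib)
      qed
      show "ennreal A \<le> mass t" if t: "T / 2 \<le> t" "t < T" for t
      proof -
        have t0: "0 \<le> t" using t T_ge by simp
        have "T / 2 * G \<le> t * G" using t G by (intro mult_right_mono) auto
        then have "ennreal (T / 2 * G) \<le> ennreal t * ennreal G"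
          using t0 G by (simp add: ennreal_mult[symmetric] ennreal_leI)
        also have "\<dots> \<le> ennreal t * I" by (intro mult_left_mono G) simp
        also have "\<dots> \<le> (\<integral>\<^sup>+x. ennreal (wave_R g x t) * indicator (cball 0 (t + k)) x \<partial>lborel)"
          unfolding I_def by (rule nn_integral_wave_R_ge[OF cont_g nn t0])
        finally have "ennreal \<epsilon> * ennreal (T / 2 * G) \<le> ennreal \<epsilon> * (\<integral>\<^sup>+x. ennreal (wave_R g x t) * indicator (cball 0 (t + k)) x \<partial>lborel)"
          by (rule mult_left_mono) simp
        also have "\<dots> \<le> (\<integral>\<^sup>+x. ennreal (\<epsilon> * wave_R g x t) * indicator (cball 0 (t + k)) x \<partial>lborel)"
        proof -
          have [measurable]: "(\<lambda>x. wave_R g x t) \<in> borel_measurable borel"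
            unfolding wave_R_def disc_integral_eq by measurable
          show ?thesis
            by (subst nn_integral_cmult[symmetric])
              (use e t0 in \<open>auto simp: ennreal_mult wave_R_nonneg nn mult.assoc\<close>)
        qed
        also have "\<dots> \<le> mass t"
          unfolding mass_def using t t0 by (intro nn_integral_mono)
            (auto split: split_indicator intro!: ennreal_leI simp: sol' duh)
        finally show ?thesis using e T_ge G unfolding A_def by (subst ennreal_mult) auto
      qed
      have "C * \<epsilon> powr (- (p - 1)) < 2 * C * \<epsilon> powr (- (p - 1))" using C e by simp
      also have "\<dots> \<le> c powr (4 - 2 * p) * \<epsilon> powr (- (p - 1))" using cC by (intro mult_right_mono) auto
      also have "\<dots> = (c * \<epsilon> powr (- (p - 1) / (4 - 2 * p))) powr (4 - 2 * p)"
        using c p_range e by (simp add: powr_mult powr_powr)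
      also have "\<dots> \<le> T powr (4 - 2 * p)" using asm c p_range by (intro powr_mono2) auto
      finally have main: "C * \<epsilon> powr (- (p - 1)) < T powr (4 - 2 * p)" .
      have "2 * (4 * pi * T\<^sup>2) * (1 + T) / A \<le> 2 * (4 * pi * T\<^sup>2) * (2 * T) / A"
        using A T_ge by (intro divide_right_mono mult_left_mono) auto
      also have "\<dots> = 32 * pi / G * (T\<^sup>2 / \<epsilon>)"
        using e T_ge G by (simp add: A_def power2_eq_square field_simps)
      finally have "(2 * (4 * pi * T\<^sup>2) * (1 + T) / A) powr (p - 1) \<le> (32 * pi / G * (T\<^sup>2 / \<epsilon>)) powr (p - 1)"
        using A T_ge p_range by (intro powr_mono2) auto
      also have "\<dots> = (32 * pi / G) powr (p - 1) * ((T\<^sup>2) powr (p - 1) * \<epsilon> powr (- (p - 1)))"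
        using e T_ge G powr_minus_divide[of \<epsilon> "p - 1"] by (simp add: powr_mult powr_divide)
      finally have "8 * (2 * (4 * pi * T\<^sup>2) * (1 + T) / A) powr (p - 1) \<le>
        8 * ((32 * pi / G) powr (p - 1) * ((T\<^sup>2) powr (p - 1) * \<epsilon> powr (- (p - 1))))" by simp
      also have "\<dots> = (1 - q)\<^sup>2 / 4 * (T\<^sup>2) powr (p - 1) * (C * \<epsilon> powr (- (p - 1)))"
        using q by (simp add: C_def)
      also have "\<dots> < (1 - q)\<^sup>2 / 4 * (T\<^sup>2) powr (p - 1) * T powr (4 - 2 * p)"
        using main q T_ge by (intro mult_strict_left_mono) auto
      also have "\<dots> = (1 - q)\<^sup>2 / 4 * T\<^sup>2"
      proof -
        have "T\<^sup>2 = T powr 2" using T_ge by (simp add: powr_numeral)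
        then have "(T\<^sup>2) powr (p - 1) * T powr (4 - 2 * p) = T powr (2 * (p - 1) + (4 - 2 * p))"
          by (simp only: powr_add powr_powr)
        also have "\<dots> = T\<^sup>2" using T_ge by (simp add: powr_numeral)
        finally show ?thesis by simp
      qed
      also have "\<dots> = (T / 2 * (1 - q))\<^sup>2" by (simp add: power_mult_distrib power_divide)
      finally show "8 * (2 * (4 * pi * T\<^sup>2) * (1 + T) / A) powr (p - 1) < (T / 2 * (1 - sqrt (2 powr (1 - p))))\<^sup>2"
        by (simp add: q_def)
    qed
  qed
qed

text \<open>About \<open>log 2 (1 / m)\<close> doublings suffice, so \<open>5 ^ n\<close> is bounded
  by a power of \<open>1 / m\<close> and is absorbed by the exponential of a multiple of
  \<open>1 / sqrt m\<close>.\<close>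

lemma critical_nonexistence:
  fixes k :: real and f g :: "real^2 \<Rightarrow> real"
  assumes k: "k \<ge> 1" and cont: "continuous_on UNIV f" "continuous_on UNIV g"
    and supp: "\<And>y. norm y > k \<Longrightarrow> f y = 0" "\<And>y. norm y > k \<Longrightarrow> g y = 0"
    and M: "(LINT x|lborel. f x + g x) > 0"
  shows "\<exists>\<epsilon>\<^sub>1>0. \<exists>c>0. \<forall>\<epsilon> T u. 0 < \<epsilon> \<and> \<epsilon> \<le> \<epsilon>\<^sub>1 \<and> T \<ge> exp (c * \<epsilon> powr (- 1 / 2)) \<and>
    continuous_on (space_time T) u \<longrightarrow> \<not> solves_integral_eq 2 \<epsilon> f g T u"
proof -
  obtain l \<mu> where l: "l \<ge> 1" and \<mu>: "\<mu> > 0"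
    and lin: "\<And>x t. norm x \<le> t - l \<Longrightarrow> \<mu> / (2 * pi * sqrt (t\<^sup>2 - (norm x)\<^sup>2)) \<le> u_lin f g x t"
    using u_lin_lower_bound[OF cont supp k M] by blast
  \<comment> \<open>\<open>2 ^ 53 * l\<close> is the constant factor left after the estimate of
    \<open>5 ^ n\<close> below, namely \<open>4 * l * 2 ^ 51\<close>.\<close>
  define L where "L = ln (2 ^ 53 * l)"
  have L: "L \<ge> 0" "exp L = 2 ^ 53 * l" using l by (simp_all add: L_def)
  define d where "d = L + 6 + 8 * sqrt (24 * pi)"
  have d: "d > 0" unfolding d_def using L by (intro add_nonneg_pos add_pos_nonneg) auto
  show ?thesis
  \<comment> \<open>This choice of \<open>\<epsilon>\<^sub>1\<close> gives \<open>m \<le> 1\<close>,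
    hence \<open>z \<ge> 1\<close>, so that the constant \<open>L\<close> is at most
    \<open>L * z\<close> and can be merged into \<open>d * z\<close>.\<close>
  proof (rule exI[of _ "1 / \<mu>"], intro exI[of _ "d / sqrt \<mu>"] conjI allI impI notI)
    show "0 < 1 / \<mu>" "0 < d / sqrt \<mu>" using \<mu> d by simp_all
    fix \<epsilon> T :: real and u :: "(real^2) \<times> real \<Rightarrow> real"
    assume asm: "0 < \<epsilon> \<and> \<epsilon> \<le> 1 / \<mu> \<and> T \<ge> exp (d / sqrt \<mu> * \<epsilon> powr (- 1 / 2)) \<and> continuous_on (space_time T) u"
      and sol: "solves_integral_eq 2 \<epsilon> f g T u"
    define m where "m = \<epsilon> * \<mu>"
    have m_bounds: "m > 0" "m \<le> 1" using asm \<mu> by (simp_all add: m_def field_simps)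
    define z where "z = 1 / sqrt m"
    have z: "z \<ge> 1" "m = 1 / z\<^sup>2" using m_bounds by (simp_all add: z_def power_divide real_sqrt_le_1_iff)
    have T: "T > 0" using asm exp_gt_zero by (meson less_le_trans)
    have sol': "u (x, t) = \<epsilon> * u_lin f g x t + duhamel_L 2 (\<lambda>z. \<bar>u z\<bar> powr 2) x t" if "0 \<le> t" "t < T" for x t
      using sol that by (auto simp: solves_integral_eq_def space_time_def)
    have lin': "m / (2 * pi * sqrt (t\<^sup>2 - (norm x)\<^sup>2)) \<le> \<epsilon> * u_lin f g x t" if "norm x \<le> t - l" for x t
      using mult_left_mono[OF lin[OF that], of \<epsilon>] asm by (simp add: m_def)
    have pos: "0 \<le> m / (2 * pi * sqrt (t\<^sup>2 - (norm x)\<^sup>2))" if "norm x \<le> t - l" for x :: "real^2" and t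
    proof -
      have "norm x \<le> t" using that l by linarith
      then show ?thesis using m_bounds by (simp add: power_mono)
    qed
    interpret critical_supersolution 2 T l u m
      using T asm l m_bounds by unfold_locales (auto simp: sol' lin' intro: order_trans[OF pos lin'])
    obtain n where n: "2 ^ 16 / m \<le> 2 ^ n" "2 ^ n \<le> 2 * (2 ^ 16 / m)"
    proof (rule two_power_between)
      show "1 \<le> 2 ^ 16 / m" using m_bounds by simp
    qed
    show False
    proof (rule critical_blowup)
      have "2 ^ 16 \<le> m * 2 ^ n" using n(1) m_bounds by (simp add: divide_le_eq mult.commute)
      then show "2 ^ 15 \<le> m * (2 ^ n - 1)" using m_bounds(2) by (simp add: algebra_simps)
      \<comment> \<open>Replacing 5 by 8 makes the power a cube of \<open>2 ^ n\<close>, which the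
        choice of \<open>n\<close> controls by \<open>2 ^ 17 / m\<close>.\<close>
      have "(5::real) ^ n \<le> 8 ^ n" by (intro power_mono) auto
      also have "\<dots> = (2 ^ n) ^ 3" by (simp add: power_mult[symmetric] mult.commute[of n] power_mult)
      also have "\<dots> \<le> (2 * (2 ^ 16 / m)) ^ 3" using n(2) by (intro power_mono) auto
      also have "\<dots> = 2 ^ 51 * z ^ 6" using z by (simp add: power_divide power_mult_distrib power_mult[symmetric])
      also have "\<dots> \<le> 2 ^ 51 * exp (6 * z)"
      proof -
        have "z \<le> exp z" using exp_ge_add_one_self[of z] by linarith
        then have "z ^ 6 \<le> exp z ^ 6" using z by (intro power_mono) auto
        also have "\<dots> = exp (6 * z)" by (simp add: exp_of_nat_mult[symmetric])
        finally show ?thesis by simp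
      qed
      finally have "4 * (l * 5 ^ n * exp (8 * sqrt (24 * pi / m))) \<le> 4 * (l * (2 ^ 51 * exp (6 * z)) * exp (8 * sqrt (24 * pi / m)))"
        using l by (intro mult_left_mono mult_right_mono) auto
      also have "\<dots> = exp L * exp (6 * z) * exp (8 * (sqrt (24 * pi) * z))"
        unfolding L(2) z_def by (simp add: real_sqrt_divide)
      also have "\<dots> = exp (L + 6 * z + 8 * (sqrt (24 * pi) * z))" by (simp add: exp_add)
      also have "\<dots> \<le> exp (d * z)"
      proof -
        have "L * 1 \<le> L * z" using z L by (intro mult_left_mono) auto
        then show ?thesis by (simp add: d_def algebra_simps)
      qed
      also have "d * z = d / sqrt \<mu> * \<epsilon> powr (- 1 / 2)"
      proof -
        have "\<epsilon> powr (- 1 / 2) = 1 / sqrt \<epsilon>"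
          using asm powr_minus_divide[of \<epsilon> "1 / 2"] by (simp add: powr_half_sqrt)
        then show ?thesis by (simp add: z_def m_def real_sqrt_mult)
      qed
      finally show "4 * (l * 5 ^ n * exp (8 * sqrt (24 * pi / m))) \<le> T" using asm by linarith
    qed
  qed
qed

theorem theorem2p3:
  fixes p k :: real and f g :: "real^2 \<Rightarrow> real"
  assumes "1 < p" and "p \<le> 2" and "k \<ge> 1"
    and "f \<in> C2_0" and "g \<in> C1_0"
    and "supp_on UNIV (\<lambda>x. (f x, g x)) \<subseteq> {x. norm x \<le> k}"
    and "(p < 2 \<and> (\<forall>x. f x = 0) \<and> (\<forall>x. g x \<ge> 0) \<and> (\<exists>x. g x \<noteq> 0)) \<or>
         (p = 2 \<and> (LINT x|lborel. f x + g x) > 0)"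
  shows "\<exists>\<epsilon>\<^sub>1>0. \<exists>c>0. \<forall>\<epsilon> T. 0 < \<epsilon> \<and> \<epsilon> \<le> \<epsilon>\<^sub>1 \<and>
           T \<ge> (if p < 2 then c * \<epsilon> powr (- (p - 1) / (4 - 2 * p))
                else exp (c * \<epsilon> powr (- 1 / 2))) \<longrightarrow>
           \<not> (\<exists>u :: (real^2) \<times> real \<Rightarrow> real.
                C1_on (space_time T) u \<and>
                supp_on (space_time T) u \<subseteq> {(x, t). t \<ge> 0 \<and> norm x \<le> t + k} \<and>
                solves_integral_eq p \<epsilon> f g T u)"
proof -
  have cont: "continuous_on UNIV f" "continuous_on UNIV g"
    using assms by (auto simp: C2_0_def C1_0_def C1_on_continuous C2_on_continuous)
  have supp: "f y = 0" "g y = 0" if "norm y > k" for y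
    using supp_on_subsetD[OF assms(6), of y] that by (auto simp: zero_prod_def)
  have cont_u: "continuous_on (space_time T) u" if "C1_on (space_time T) u" for T and u :: "(real^2) \<times> real \<Rightarrow> real"
    using that C1_on_continuous by blast
  from assms(7) show ?thesis
  proof
    assume case_i: "p < 2 \<and> (\<forall>x. f x = 0) \<and> (\<forall>x. g x \<ge> 0) \<and> (\<exists>x. g x \<noteq> 0)"
    then obtain z where z: "g z \<noteq> 0" by blast
    have f: "f = (\<lambda>x. 0)" using case_i by auto
    obtain c where "c > 0" and c: "\<And>\<epsilon> T u. 0 < \<epsilon> \<Longrightarrow> \<epsilon> \<le> 1 \<Longrightarrow> T \<ge> c * \<epsilon> powr (- (p - 1) / (4 - 2 * p)) \<Longrightarrow>
        continuous_on (space_time T) u \<Longrightarrow> \<not> solves_integral_eq p \<epsilon> f g T u"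
      using subcritical_nonexistence[OF assms(1) _ assms(3) cont(2) supp(2) _ z] case_i f by auto
    then show ?thesis
      using case_i cont_u by (intro exI[of _ 1] conjI exI[of _ c]) auto
  next
    assume case_ii: "p = 2 \<and> (LINT x|lborel. f x + g x) > 0"
    with critical_nonexistence[OF assms(3) cont supp] show ?thesis
      using cont_u by simp meson
  qed
qed

end
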